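(* Let $d>0$, let finitely many positions in $(0,d]$ be given together with amounts of depot fuel available for use at these positions and amounts of fuel that have to be present there at the end, and fix one of the two cases "one-way trip" (the jeep must end at the oasis) or "round trip" (the jeep must reach the oasis and end at the desert border). Let $T$ be the run of the backward convoy algorithm described in the context (without the ringle jeep in the one-way case, with the ringle jeep in the round-trip case). Then: (1) $T$ is optimal: every normal algorithm for the given task (same depots to be used, same depots to be filled, same case) uses at least as much fuel from the desert border as $T$ does; (2) $T$ can be executed as a normal algorithm: there is a normal algorithm for the given task that uses from the desert border the same amount of fuel as $T$.
   Context: **The problem.** The desert is the interval $[0,d]$; the desert border is position $0$, where unlimited fuel is available, and the oasis is position $d$. A *Fine jeep* has a fuel capacity of one tankload, uses one tankload per distance unit, and may set up depots of any amount of fuel at any position for later use. A *normal algorithm* is an ordinary schedule in time for one Fine jeep starting at $0$: at each time the jeep only uses fuel in its tank, and it can only take fuel from a position where fuel is present at that time (fuel initially in a depot, fuel put there earlier by the jeep, or fuel of the border). There are finitely many depots with fuel to be used (initially present) and finitely many depots to be filled (a prescribed amount has to be present at the end); a position may be of both kinds. In the one-way case the jeep has to end at the oasis; in the round-trip case it has to reach the oasis and end at the border. The cost is the amount of fuel used from the desert border (if returning fuel at the border is allowed, returned fuel is subtracted). **Backward convoys.** A backward convoy rides from $d$ to $0$ and consists of jeeps that are always at one common position. A *single jeep* (an outward passage) and a *ringle jeep* (a returning single jeep, i.e. a return passage) each have tank capacity one tankload and consume one tankload per distance unit; a *double jeep* (an outward and a return passage) has tank capacity two tankloads and consumes two tankloads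 per distance unit. The convoy consists of two sub-convoys, each with its own common pool of tank fuel: * the *forward refueling sub-convoy*: one single jeep and some number of double jeeps; it contains at most one tankload of fuel in total; * the *backward refueling sub-convoy*: some number of double jeeps and, in the round-trip case, the ringle jeep; it has at most one tankload of *emptiness* (total tank capacity minus total tank fuel). It is called improper if it has no jeeps or consists of one empty ringle jeep only. To *cancel* a double jeep with one tankload of fuel means to remove one double jeep and one tankload of fuel from the sub-convoy; to *create* (add) a double jeep with one tankload of fuel is the reverse operation. **The algorithm.** Start at $d$ with a single jeep with one tankload of fuel and, in the round-trip case, an empty ringle jeep. Ride to $0$, executing the handlers below at all depots (including at $d$). Each time the forward refueling sub-convoy gets out of fuel, a double jeep with one tankload of fuel is added to it. A backward refueling sub-convoy consisting only of one empty ringle jeep uses fuel of the forward refueling sub-convoy. While riding, the backward refueling sub-convoy cancels a double jeep with one tankload of fuel each time it gets more than one tankload of emptiness. *Event 1: the convoy meets a depot with fuel to be used.* If fuel also has to be put (restored) at this position, first execute the handler of Event 2. The forward refueling sub-convoy absorbs as much fuel as possible; each time it gets more than one tankload of fuel, it cancels a double jeep with one tankload of fuel. If there is more fuel than the forward refueling sub-convoy can accept, the backward refueling sub-convoy absorbs all remaining fuel; it creates a double jeep with one tankload of fuel each time it gets more fuel than it can absorb (such a new double jeep can then absorb one further tankload). *Event 2: the convoy meets a depot to be filled.* Use fuel of the backward refueling sub-convoy, canceling a double jeep with one tankload of fuel each time this sub-convoy gets more than one tankload of emptiness. If more fuel is needed than the backward refueling sub-convoy can give, the forward refueling sub-convoy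 gives the remaining fuel; to do this it creates as many double jeeps with one tankload of fuel each as necessary. *At the border.* The tanks of the forward refueling sub-convoy are filled up to one tankload per jeep, using border fuel. If returning fuel is allowed, the fuel of the double jeeps of the backward refueling sub-convoy above the level of one tankload per double jeep, and all fuel of the ringle jeep, is returned. Thus the amount of fuel used from the border is (number of jeeps of the forward refueling sub-convoy) minus (total fuel in that sub-convoy on arrival at $0$), minus the returned fuel if returning is allowed. *)

theory Defs
  imports Complex_Main
begin

text \<open>
  Positions are real numbers; one tankload and one distance unit both have size 1. The fields
  \<open>available\<close> and \<open>required\<close> only matter at the positions in \<open>depots\<close>. A depot to be used but not filled
  has \<open>required\<close> 0, a depot to be filled but not used has \<open>available\<close> 0.
\<close>

record task =
  oasis :: real
  depots :: "real set"
  available :: "real \<Rightarrow> real"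
  required :: "real \<Rightarrow> real"
  round_trip :: bool
  returning :: bool  \<comment> \<open>whether fuel may be returned at the desert border\<close>

section \<open>Normal algorithms\<close>

text \<open>
  \<open>spent\<close> is the fuel used from the border so far, minus the fuel returned to it. The unlimited border
  fuel is not part of \<open>stock\<close>: \<open>stock 0\<close> is the content of a depot which the jeep itself may have
  set up at position 0, and using that depot does not affect \<open>spent\<close>.
\<close>

record jeep =
  loc :: real
  tank :: real
  stock :: "real \<Rightarrow> real"
  spent :: real

inductive jeep_step :: "task \<Rightarrow> jeep \<Rightarrow> jeep \<Rightarrow> bool" for J where
  drive: "0 \<le> y \<Longrightarrow> y \<le> oasis J \<Longrightarrow> \<bar>y - loc s\<bar> \<le> tank s \<Longrightarrow>
    jeep_step J s (s\<lparr>loc := y, tank := tank s - \<bar>y - loc s\<bar>\<rparr>)"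
| load: "0 \<le> a \<Longrightarrow> a \<le> stock s (loc s) \<Longrightarrow> tank s + a \<le> 1 \<Longrightarrow>
    jeep_step J s (s\<lparr>tank := tank s + a, stock := (stock s)(loc s := stock s (loc s) - a)\<rparr>)"
| unload: "0 \<le> a \<Longrightarrow> a \<le> tank s \<Longrightarrow>
    jeep_step J s (s\<lparr>tank := tank s - a, stock := (stock s)(loc s := stock s (loc s) + a)\<rparr>)"
| draw: "loc s = 0 \<Longrightarrow> 0 \<le> a \<Longrightarrow> tank s + a \<le> 1 \<Longrightarrow>
    jeep_step J s (s\<lparr>tank := tank s + a, spent := spent s + a\<rparr>)"
| give_back: "returning J \<Longrightarrow> loc s = 0 \<Longrightarrow> 0 \<le> a \<Longrightarrow> a \<le> tank s \<Longrightarrow>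
    jeep_step J s (s\<lparr>tank := tank s - a, spent := spent s - a\<rparr>)"

definition jeep_start :: "task \<Rightarrow> jeep" where
  "jeep_start J = \<lparr>loc = 0, tank = 0, stock = (\<lambda>x. if x \<in> depots J then available J x else 0), spent = 0\<rparr>"

definition normal_algorithm :: "task \<Rightarrow> jeep list \<Rightarrow> bool" where
  "normal_algorithm J ss \<longleftrightarrow>
     ss \<noteq> [] \<and> hd ss = jeep_start J \<and>
     (\<forall>i. Suc i < length ss \<longrightarrow> jeep_step J (ss ! i) (ss ! Suc i)) \<and>
     (\<exists>s\<in>set ss. loc s = oasis J) \<and>
     loc (last ss) = (if round_trip J then 0 else oasis J) \<and>
     (\<forall>x\<in>depots J. required J x \<le> stock (last ss) x)"

definition normal_cost :: "jeep list \<Rightarrow> real" where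
  "normal_cost ss = spent (last ss)"

section \<open>The backward convoy\<close>

text \<open>
  The forward refueling sub-convoy consists of one single jeep and \<open>fwd_doubles\<close> double jeeps, the
  backward refueling sub-convoy of \<open>bwd_doubles\<close> double jeeps and, for a round trip, the ringle jeep.
  \<open>fwd_fuel\<close> and \<open>bwd_fuel\<close> are the two pools of tank fuel.
\<close>

record convoy =
  fwd_doubles :: nat
  fwd_fuel :: real
  bwd_doubles :: nat
  bwd_fuel :: real

definition ringles :: "task \<Rightarrow> nat" where
  "ringles J = (if round_trip J then 1 else 0)"

definition emptiness :: "task \<Rightarrow> convoy \<Rightarrow> real" where
  "emptiness J c = 2 * real (bwd_doubles c) + real (ringles J) - bwd_fuel c"

definition improper :: "convoy \<Rightarrow> bool" where
  "improper c \<longleftrightarrow> bwd_doubles c = 0 \<and> bwd_fuel c = 0"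

definition fwd_rate :: "task \<Rightarrow> convoy \<Rightarrow> real" where
  "fwd_rate J c = 2 * real (fwd_doubles c) + 1 + (if improper c then real (ringles J) else 0)"

definition bwd_rate :: "task \<Rightarrow> convoy \<Rightarrow> real" where
  "bwd_rate J c = (if improper c then 0 else 2 * real (bwd_doubles c) + real (ringles J))"

definition fwd_create :: "nat \<Rightarrow> convoy \<Rightarrow> convoy" where
  "fwd_create k c = c\<lparr>fwd_doubles := fwd_doubles c + k, fwd_fuel := fwd_fuel c + real k\<rparr>"

definition fwd_cancel :: "convoy \<Rightarrow> convoy" where
  "fwd_cancel c = c\<lparr>fwd_doubles := fwd_doubles c - 1, fwd_fuel := fwd_fuel c - 1\<rparr>"

definition bwd_create :: "nat \<Rightarrow> convoy \<Rightarrow> convoy" where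
  "bwd_create k c = c\<lparr>bwd_doubles := bwd_doubles c + k, bwd_fuel := bwd_fuel c + real k\<rparr>"

definition bwd_cancel :: "convoy \<Rightarrow> convoy" where
  "bwd_cancel c = c\<lparr>bwd_doubles := bwd_doubles c - 1, bwd_fuel := bwd_fuel c - 1\<rparr>"

function fwd_cancel_all :: "convoy \<Rightarrow> convoy" where
  "fwd_cancel_all c =
     (if fwd_doubles c > 0 \<and> fwd_fuel c > 1 then fwd_cancel_all (fwd_cancel c) else c)"
  by pat_completeness auto
termination
  by (relation "measure fwd_doubles") (auto simp: fwd_cancel_def)

function bwd_cancel_all :: "task \<Rightarrow> convoy \<Rightarrow> convoy" where
  "bwd_cancel_all J c =
     (if bwd_doubles c > 0 \<and> emptiness J c > 1 then bwd_cancel_all J (bwd_cancel c) else c)"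
  by pat_completeness auto
termination
  by (relation "measure (bwd_doubles \<circ> snd)") (auto simp: bwd_cancel_def)

declare fwd_cancel_all.simps [simp del] bwd_cancel_all.simps [simp del]

text \<open>
  Filling a depot. Canceling a double jeep takes one tankload of fuel with it, so the backward
  refueling sub-convoy can give at most its fuel minus one tankload per double jeep. The forward
  refueling sub-convoy gives the rest \<open>r\<close> and creates the least number of double jeeps for which
  its fuel does not become negative.
\<close>

definition fill_depot :: "task \<Rightarrow> real \<Rightarrow> convoy \<Rightarrow> convoy" where
  "fill_depot J p c =
     (let q = min p (bwd_fuel c - real (bwd_doubles c));
          c1 = bwd_cancel_all J (c\<lparr>bwd_fuel := bwd_fuel c - q\<rparr>);
          r = p - q;
          c2 = fwd_create (nat \<lceil>r - fwd_fuel c1\<rceil>) c1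
      in c2\<lparr>fwd_fuel := fwd_fuel c2 - r\<rparr>)"

text \<open>
  Using a depot. The forward refueling sub-convoy can absorb the emptiness of a single jeep
  (\<open>1 - fwd_fuel\<close>) and one further tankload for every double jeep that is canceled. Each double jeep
  created with one tankload of fuel raises the emptiness of the backward refueling sub-convoy by one
  tankload, and as few of them as possible are created to absorb the rest \<open>r\<close>.
\<close>

definition use_depot :: "task \<Rightarrow> real \<Rightarrow> convoy \<Rightarrow> convoy" where
  "use_depot J u c =
     (let a = min u (real (fwd_doubles c) + 1 - fwd_fuel c);
          c1 = fwd_cancel_all (c\<lparr>fwd_fuel := fwd_fuel c + a\<rparr>);
          r = u - a;
          c2 = bwd_create (nat \<lceil>r - emptiness J c1\<rceil>) c1
      in c2\<lparr>bwd_fuel := bwd_fuel c2 + r\<rparr>)"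

definition visit_depot :: "task \<Rightarrow> real \<Rightarrow> convoy \<Rightarrow> convoy" where
  "visit_depot J x c = use_depot J (available J x) (fill_depot J (required J x) c)"

text \<open>
  Riding from \<open>x\<close> down to \<open>y\<close>, without depots in between. A double jeep of the backward refueling
  sub-convoy is canceled when the emptiness has reached one tankload and the convoy rides on, i.e. when
  the emptiness is about to exceed one tankload. In the final branch, the convoy rides until it is at \<open>y\<close>,
  the forward refueling sub-convoy is out of fuel, or the emptiness of a proper backward refueling
  sub-convoy reaches one tankload (for a ringle jeep alone: until it is empty).
  The recursion ends for every reachable convoy: its consumption grows at most linearly with the
  number of created double jeeps, and riding one tankload takes a distance whose sum over all these
  numbers diverges.
\<close>

partial_function (tailrec) ride :: "task \<Rightarrow> real \<Rightarrow> real \<Rightarrow> convoy \<Rightarrow> convoy" where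
  "ride J x y c =
     (if fwd_fuel c \<le> 0 then ride J x y (fwd_create 1 c)
      else if x \<le> y then c
      else if bwd_doubles c > 0 \<and> emptiness J c \<ge> 1 then ride J x y (bwd_cancel c)
      else
        let l0 = min (x - y) (fwd_fuel c / fwd_rate J c);
            l = (if improper c then l0 else min l0 ((1 - emptiness J c) / bwd_rate J c))
        in ride J (x - l) y (c\<lparr>fwd_fuel := fwd_fuel c - l * fwd_rate J c,
                               bwd_fuel := bwd_fuel c - l * bwd_rate J c\<rparr>))"

fun tour :: "task \<Rightarrow> real \<Rightarrow> real list \<Rightarrow> convoy \<Rightarrow> convoy" where
  "tour J x [] c = ride J x 0 c"
| "tour J x (p # ps) c = tour J p ps (visit_depot J p (ride J x p c))"

definition convoy_start :: convoy where
  "convoy_start = \<lparr>fwd_doubles = 0, fwd_fuel = 1, bwd_doubles = 0, bwd_fuel = 0\<rparr>"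

definition convoy_arrival :: "task \<Rightarrow> convoy" where
  "convoy_arrival J = tour J (oasis J) (rev (sorted_list_of_set (depots J))) convoy_start"

text \<open>
  Returned are all fuel of the ringle jeep and the fuel of the double jeeps above one tankload
  each, which together is the fuel of the sub-convoy minus one tankload per double jeep.
\<close>

definition convoy_cost :: "task \<Rightarrow> real" where
  "convoy_cost J =
     (let c = convoy_arrival J
      in real (fwd_doubles c) + 1 - fwd_fuel c
         - (if returning J then bwd_fuel c - real (bwd_doubles c) else 0))"

end

(*
  Only two net flows matter at a position x: the fuel N that has to be carried across x to the right
  before the surplus from beyond x can be used, and the surplus B that is carried back across x.
  Between depots, the convoy makes N and B piecewise linear functions of x, where N - B is the
  net amount of fuel that crosses x in total.

  Optimality: for an arbitrary schedule, let N be the maximum over time and N - B the final value of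
  the net flow across x. A maximum larger than a requires a + 1 outward passages before it is
  attained, and returning more than b tankloads afterwards requires more than b return passages.
  Every passage burns fuel, so N and N - B are at least what the convoy has, by induction
  from the oasis to the border.

  Execution: the passages over an interval between two events can be done consecutively by shuttling
  between the two end points of it. For a one-way trip, the schedule is interrupted at a moment that
  the surplus is available at the left end point.
*)

theory Submission
  imports Defs
begin

section \<open>The convoy in terms of net flows\<close>

text \<open>The relation \<open>plan\<close> separates both halves of the theorem from the
  algorithm. It keeps only N and B, because creating or canceling a double jeep with one tankload
  leaves both unchanged. The jeep counts survive as the witnesses \<open>a\<close> and
  \<open>b\<close> of \<open>leg\<close>: on a stretch ridden with them, N lies between
  \<open>a\<close> and \<open>a + 1\<close>, and \<open>b + r - B\<close>, which is the emptiness,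
  lies between 0 and 1 unless the backward sub-convoy is improper. Optimality and execution are both
  proved for an arbitrary plan; the convoy enters only by providing one with its cost. Two obstacles
  shape these halves. A schedule may stop anywhere between depots, while counting passages requires
  a stretch without stops; hence legs must be divisible at every point. In a one-way trip, the
  surplus from beyond x may be wanted left of x before the jeep has finished beyond x. After
  bringing the surplus back it has to cross once more, so fuel for this crossing must be kept as a
  reserve.\<close>

definition avail :: "task \<Rightarrow> real \<Rightarrow> real" where
  "avail J x = (if x \<in> depots J then available J x else 0)"

definition req :: "task \<Rightarrow> real \<Rightarrow> real" where
  "req J x = (if x \<in> depots J then required J x else 0)"

text \<open>Effect of the depot at \<open>x\<close>: \<open>N\<close> and \<open>B\<close> are the
  values on its right side, the results those on its left side. The three terms of the maximum bound
  the peak of the net flow by its values at the start, at the old peak, and at the end, when the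
  required fuel is present. \<open>surplus_left\<close> is then forced, since peak minus surplus is
  the final net flow.\<close>

definition need_left :: "task \<Rightarrow> real \<Rightarrow> real \<Rightarrow> real \<Rightarrow> real" where
  "need_left J x N B = max 0 (max (N - avail J x) (N - B + req J x - avail J x))"

definition surplus_left :: "task \<Rightarrow> real \<Rightarrow> real \<Rightarrow> real \<Rightarrow> real" where
  "surplus_left J x N B = need_left J x N B - (N - B + req J x - avail J x)"

text \<open>
  Riding a distance \<open>l\<close> with \<open>a\<close> and \<open>b\<close> double jeeps in the forward and the backward refueling
  sub-convoy. The first disjunct is the case of an improper backward refueling sub-convoy.
\<close>

definition leg :: "nat \<Rightarrow> real \<Rightarrow> real \<Rightarrow> real \<Rightarrow> real \<Rightarrow> real \<Rightarrow> bool" where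
  "leg r l N B N' B' \<longleftrightarrow> (\<exists>a b. real a \<le> N \<and> N' \<le> real a + 1 \<and>
     (B = 0 \<and> B' = 0 \<and> N' = N + (2 * real a + 1 + real r) * l \<or>
      1 \<le> b + r \<and> B \<le> real (b + r) \<and> real (b + r) \<le> B' + 1 \<and>
      N' = N + (2 * real a + 1) * l \<and> B' = B - (2 * real b + real r) * l))"

text \<open>The values at a point are those just right of it, with its depot not yet handled. This
  also covers a depot at the oasis. A step may end at a point without a depot, since the depot rule
  changes nothing there.\<close>

inductive plan :: "task \<Rightarrow> real \<Rightarrow> real \<Rightarrow> real \<Rightarrow> bool" for J where
  start: "plan J (oasis J) 0 0"
| step: "plan J x N B \<Longrightarrow> 0 \<le> y \<Longrightarrow> y < x \<Longrightarrow> depots J \<inter> {y<..<x} = {} \<Longrightarrow>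
    leg (ringles J) (x - y) (need_left J x N B) (surplus_left J x N B) N' B' \<Longrightarrow> plan J y N' B'"

lemma surplus_left_nonneg: "0 \<le> surplus_left J x N B"
  by (auto simp: surplus_left_def need_left_def)

lemma left_not_depot:
  assumes "x \<notin> depots J" "0 \<le> N" "0 \<le> B"
  shows "need_left J x N B = N" "surplus_left J x N B = B"
  using assms by (auto simp: surplus_left_def need_left_def avail_def req_def)

lemma leg_nonneg:
  assumes "leg r l N B N' B'" "0 \<le> l"
  shows "0 \<le> N" "0 \<le> N'" "0 \<le> B'"
  using assms unfolding leg_def by (auto intro: add_nonneg_nonneg mult_nonneg_nonneg)

text \<open>The same \<open>a\<close> and \<open>b\<close> serve both pieces: \<open>N\<close> never
  decreases and \<open>B\<close> never increases along a leg, so the bounds at its ends hold in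
  between as well.\<close>

lemma leg_split:
  assumes "leg r l N B N' B'" "0 < l1" "l1 < l"
  obtains N1 B1 where "leg r l1 N B N1 B1" "leg r (l - l1) N1 B1 N' B'"
proof -
  obtain a b where a: "real a \<le> N" "N' \<le> real a + 1"
    and ab: "B = 0 \<and> B' = 0 \<and> N' = N + (2 * real a + 1 + real r) * l \<or>
      1 \<le> b + r \<and> B \<le> real (b + r) \<and> real (b + r) \<le> B' + 1 \<and>
      N' = N + (2 * real a + 1) * l \<and> B' = B - (2 * real b + real r) * l"
    using assms(1) unfolding leg_def by blast
  have m: "0 \<le> c * l1" "c * l1 \<le> c * l" if "0 \<le> c" for c
    using assms that by (auto intro: mult_left_mono)
  from ab show thesis
  proof (elim disjE conjE)
    assume i: "B = 0" "B' = 0" "N' = N + (2 * real a + 1 + real r) * l"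
    define N1 where "N1 = N + (2 * real a + 1 + real r) * l1"
    have N1: "N \<le> N1" "N1 \<le> N'" "N' = N1 + (2 * real a + 1 + real r) * (l - l1)"
      using m[of "2 * real a + 1 + real r"] i(3) by (auto simp: N1_def algebra_simps)
    have "leg r l1 N 0 N1 0"
      unfolding leg_def using a N1(1,2) by (intro exI[of _ a] exI[of _ 0]) (simp add: N1_def)
    moreover have "leg r (l - l1) N1 0 N' 0"
      unfolding leg_def using a N1 by (intro exI[of _ a] exI[of _ 0]) simp
    ultimately show thesis using that i by blast
  next
    assume p: "1 \<le> b + r" "B \<le> real (b + r)" "real (b + r) \<le> B' + 1"
      "N' = N + (2 * real a + 1) * l" "B' = B - (2 * real b + real r) * l"
    define N1 where "N1 = N + (2 * real a + 1) * l1"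
    define B1 where "B1 = B - (2 * real b + real r) * l1"
    have N1: "N \<le> N1" "N1 \<le> N'" "N' = N1 + (2 * real a + 1) * (l - l1)"
      using m[of "2 * real a + 1"] p(4) by (auto simp: N1_def algebra_simps)
    have B1: "B1 \<le> B" "B' \<le> B1" "B' = B1 - (2 * real b + real r) * (l - l1)"
      using m[of "2 * real b + real r"] p(5) by (auto simp: B1_def algebra_simps)
    have "leg r l1 N B N1 B1"
      unfolding leg_def using a p(1-3) N1(1,2) B1(1,2)
      by (intro exI[of _ a] exI[of _ b]) (simp add: N1_def B1_def)
    moreover have "leg r (l - l1) N1 B1 N' B'"
      unfolding leg_def using a p(1-3) N1 B1
      by (intro exI[of _ a] exI[of _ b]) simp
    ultimately show thesis by (rule that)
  qed
qed

lemma plan_nonneg: "plan J x N B \<Longrightarrow> 0 \<le> N \<and> 0 \<le> B"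
  by (induction rule: plan.induct) (auto dest: leg_nonneg)

lemma plan_range: "plan J x N B \<Longrightarrow> 0 \<le> oasis J \<Longrightarrow> 0 \<le> x \<and> x \<le> oasis J"
  by (induction rule: plan.induct) auto

section \<open>The depot handlers and their effect on the net flows\<close>

text \<open>
  Convoy fuel is complementary to the fuel of the actual jeep: a tank of the forward refueling
  sub-convoy with fuel \<open>f\<close> accounts for \<open>1 - f\<close> carried outward. In the backward refueling sub-convoy,
  the outward passage of a double jeep is made without payload, and accounts for one tankload of its
  fuel.
\<close>

definition need :: "convoy \<Rightarrow> real" where
  "need c = real (fwd_doubles c) + 1 - fwd_fuel c"

definition surplus :: "convoy \<Rightarrow> real" where
  "surplus c = bwd_fuel c - real (bwd_doubles c)"

text \<open>The bounds are closed at both ends: fuel 0 or emptiness 1 means a creation or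
  cancellation that is left to \<open>ride\<close>. The last conjunct takes care of a sub-convoy
  without jeeps; together with nonnegative emptiness it forces its fuel to be 0.\<close>

definition regular :: "task \<Rightarrow> convoy \<Rightarrow> bool" where
  "regular J c \<longleftrightarrow> 0 \<le> fwd_fuel c \<and> fwd_fuel c \<le> 1 \<and> 0 \<le> emptiness J c \<and> emptiness J c \<le> 1 \<and>
     0 \<le> surplus c"

lemma ringles_cases: "ringles J = 0 \<or> ringles J = 1"
  by (simp add: ringles_def)

lemma regular_need_nonneg: "regular J c \<Longrightarrow> 0 \<le> need c"
  by (simp add: regular_def need_def)

text \<open>A cancellation lowers the number of double jeeps and the fuel by 1 each, which cancels
  out in \<open>need\<close>. When no double jeep is left, \<open>need\<close> being nonnegative
  already bounds the fuel by 1.\<close>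

lemma fwd_cancel_all:
  assumes "0 \<le> fwd_fuel c" "0 \<le> need c"
  shows "need (fwd_cancel_all c) = need c"
    and "bwd_doubles (fwd_cancel_all c) = bwd_doubles c" "bwd_fuel (fwd_cancel_all c) = bwd_fuel c"
    and "0 \<le> fwd_fuel (fwd_cancel_all c)" "fwd_fuel (fwd_cancel_all c) \<le> 1"
  using assms
proof (induction c rule: fwd_cancel_all.induct)
  case (1 c)
  { case 1 with "1.IH" show ?case
      by (subst fwd_cancel_all.simps) (auto simp: fwd_cancel_def need_def) }
  { case 2 with "1.IH" show ?case
      by (subst fwd_cancel_all.simps) (auto simp: fwd_cancel_def need_def) }
  { case 3 with "1.IH" show ?case
      by (subst fwd_cancel_all.simps) (auto simp: fwd_cancel_def need_def) }
  { case 4 with "1.IH" show ?case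
      by (subst fwd_cancel_all.simps) (auto simp: fwd_cancel_def need_def) }
  { case 5 with "1.IH" show ?case
      by (subst fwd_cancel_all.simps) (auto simp: fwd_cancel_def need_def) }
qed

text \<open>When no double jeep is left, the emptiness is the capacity of the ringle jeep, if any,
  minus the nonnegative \<open>surplus\<close>, hence at most 1.\<close>

lemma bwd_cancel_all:
  assumes "0 \<le> emptiness J c" "0 \<le> surplus c"
  shows "surplus (bwd_cancel_all J c) = surplus c"
    and "fwd_doubles (bwd_cancel_all J c) = fwd_doubles c" "fwd_fuel (bwd_cancel_all J c) = fwd_fuel c"
    and "0 \<le> emptiness J (bwd_cancel_all J c)" "emptiness J (bwd_cancel_all J c) \<le> 1"
  using assms
proof (induction J c rule: bwd_cancel_all.induct)
  case (1 J c)
  have r: "real (ringles J) \<le> 1" using ringles_cases[of J] by auto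
  { case 1 with "1.IH" show ?case
      by (subst bwd_cancel_all.simps) (auto simp: bwd_cancel_def emptiness_def surplus_def) }
  { case 2 with "1.IH" show ?case
      by (subst bwd_cancel_all.simps) (auto simp: bwd_cancel_def emptiness_def surplus_def) }
  { case 3 with "1.IH" show ?case
      by (subst bwd_cancel_all.simps) (auto simp: bwd_cancel_def emptiness_def surplus_def) }
  { case 4 with "1.IH" show ?case
      by (subst bwd_cancel_all.simps) (auto simp: bwd_cancel_def emptiness_def surplus_def) }
  { case 5 with "1.IH" r show ?case
      by (subst bwd_cancel_all.simps) (auto simp: bwd_cancel_def emptiness_def surplus_def) }
qed

text \<open>Creation and cancellation keep \<open>need\<close> and \<open>surplus\<close>, so only
  the splitting of \<open>p\<close> counts: \<open>surplus\<close> pays \<open>q\<close>, and the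
  unpaid rest \<open>p - q\<close> raises \<open>need\<close>. The ceiling in \<open>k\<close>
  brings the forward fuel back into the unit interval.\<close>

lemma fill_depot:
  assumes c: "regular J c" and p: "0 \<le> p"
  shows "regular J (fill_depot J p c)"
    and "need (fill_depot J p c) = max (need c) (need c - surplus c + p)"
    and "surplus (fill_depot J p c) = max 0 (surplus c - p)"
proof -
  define q where "q = min p (surplus c)"
  define c0 where "c0 = c\<lparr>bwd_fuel := bwd_fuel c - q\<rparr>"
  define c1 where "c1 = bwd_cancel_all J c0"
  define k where "k = nat \<lceil>(p - q) - fwd_fuel c1\<rceil>"
  have q: "0 \<le> q" "q \<le> p" "q \<le> surplus c"
    using c p by (auto simp: q_def regular_def)
  have "0 \<le> emptiness J c0" and s0: "surplus c0 = surplus c - q" "fwd_fuel c0 = fwd_fuel c" "fwd_doubles c0 = fwd_doubles c"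
    using c q by (auto simp: c0_def emptiness_def surplus_def regular_def)
  moreover have "0 \<le> surplus c0" using s0 q by simp
  ultimately have c1: "surplus c1 = surplus c - q" "fwd_doubles c1 = fwd_doubles c"
      "fwd_fuel c1 = fwd_fuel c" "0 \<le> emptiness J c1" "emptiness J c1 \<le> 1"
    using bwd_cancel_all[of J c0] by (auto simp: c1_def)
  have eq: "fill_depot J p c = (fwd_create k c1)\<lparr>fwd_fuel := fwd_fuel c1 + real k - (p - q)\<rparr>"
    by (simp add: fill_depot_def Let_def q_def c0_def c1_def k_def surplus_def fwd_create_def)
  have "0 \<le> fwd_fuel c1 + real k - (p - q)" "fwd_fuel c1 + real k - (p - q) \<le> 1"
    using c1 c q unfolding k_def regular_def by linarith+
  moreover have "0 \<le> surplus c1" using c1 q by simp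
  ultimately show "regular J (fill_depot J p c)"
    using c1 unfolding eq by (simp add: regular_def fwd_create_def emptiness_def surplus_def)
  show "need (fill_depot J p c) = max (need c) (need c - surplus c + p)"
    "surplus (fill_depot J p c) = max 0 (surplus c - p)"
    using c1 unfolding eq by (auto simp: need_def surplus_def fwd_create_def q_def)
qed

lemma use_depot:
  assumes c: "regular J c" and u: "0 \<le> u"
  shows "regular J (use_depot J u c)"
    and "need (use_depot J u c) = max 0 (need c - u)"
    and "surplus (use_depot J u c) = surplus c + max 0 (u - need c)"
proof -
  define a where "a = min u (need c)"
  define c0 where "c0 = c\<lparr>fwd_fuel := fwd_fuel c + a\<rparr>"
  define c1 where "c1 = fwd_cancel_all c0"
  define k where "k = nat \<lceil>(u - a) - emptiness J c1\<rceil>"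
  have a: "0 \<le> a" "a \<le> u" "a \<le> need c"
    using u regular_need_nonneg[OF c] by (auto simp: a_def)
  have c0: "0 \<le> fwd_fuel c0" "need c0 = need c - a" "bwd_doubles c0 = bwd_doubles c"
      "bwd_fuel c0 = bwd_fuel c"
    using c a by (auto simp: c0_def need_def regular_def)
  then have c1: "need c1 = need c - a" "bwd_doubles c1 = bwd_doubles c"
      "bwd_fuel c1 = bwd_fuel c" "0 \<le> fwd_fuel c1" "fwd_fuel c1 \<le> 1"
    using fwd_cancel_all[of c0] a by (auto simp: c1_def)
  have e: "emptiness J c1 = emptiness J c" using c1 by (simp add: emptiness_def)
  have eq: "use_depot J u c = (bwd_create k c1)\<lparr>bwd_fuel := bwd_fuel c1 + real k + (u - a)\<rparr>"
    by (simp add: use_depot_def Let_def a_def c0_def c1_def k_def need_def bwd_create_def add_ac)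
  have "0 \<le> emptiness J c1 + real k - (u - a)" "emptiness J c1 + real k - (u - a) \<le> 1"
    using e c a unfolding k_def regular_def by linarith+
  then show "regular J (use_depot J u c)"
    using c1 c a unfolding eq by (simp add: regular_def bwd_create_def emptiness_def surplus_def)
  show "need (use_depot J u c) = max 0 (need c - u)"
    "surplus (use_depot J u c) = surplus c + max 0 (u - need c)"
    using c1 unfolding eq by (auto simp: need_def surplus_def bwd_create_def a_def)
qed

text \<open>The two handlers change \<open>need - surplus\<close> by exactly the required and minus
  the available amount, which is the balance that defines \<open>surplus_left\<close>.\<close>

lemma visit_depot:
  assumes "regular J c" "x \<in> depots J" "0 \<le> required J x" "0 \<le> available J x"
  shows "regular J (visit_depot J x c)"
    and "need (visit_depot J x c) = need_left J x (need c) (surplus c)"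
    and "surplus (visit_depot J x c) = surplus_left J x (need c) (surplus c)"
proof -
  note f = fill_depot[OF assms(1,3)]
  note u = use_depot[OF f(1) assms(4)]
  show "regular J (visit_depot J x c)" using u by (simp add: visit_depot_def)
  show "need (visit_depot J x c) = need_left J x (need c) (surplus c)"
    using u(2) f(2) assms(2) by (simp add: visit_depot_def need_left_def avail_def req_def)
  show "surplus (visit_depot J x c) = surplus_left J x (need c) (surplus c)"
    using u(3) f(2,3) assms(2) regular_need_nonneg[OF assms(1)]
    by (simp add: visit_depot_def need_left_def surplus_left_def avail_def req_def max_def split: if_splits)
qed

section \<open>Riding: termination and preservation of the plan\<close>

text \<open>
  Along a ride, the need plus 1 grows at most exponentially with rate 2. This bounds the number of
  double jeeps created, and hence the number of iterations.
\<close>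

definition ride_measure :: "task \<Rightarrow> nat \<Rightarrow> real \<Rightarrow> real \<Rightarrow> convoy \<Rightarrow> nat" where
  "ride_measure J K x y c =
     2 * (K + 1 - fwd_doubles c) + (if fwd_fuel c \<le> 0 then 0 else 1) +
     2 * bwd_doubles c + (if bwd_doubles c > 0 \<and> emptiness J c \<ge> 1 then 0 else 1) +
     (if improper c then 0 else 1) + (if x \<le> y then 0 else 1)"

text \<open>A move ends at the first of three events, and each of them lowers the measure:
  \<open>y\<close> is reached, the forward fuel is used up, or the emptiness becomes 1. The last one
  makes a cancellation due or, for a ringle jeep alone, makes the sub-convoy improper. The growth
  factor comes from \<open>fwd_rate\<close> being at most twice \<open>need + 1\<close>, even with
  an empty ringle jeep to be fed, and from \<open>1 + 2 * l \<le> exp (2 * l)\<close>.\<close>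

lemma ride_move:
  fixes J x y c
  defines "l0 \<equiv> min (x - y) (fwd_fuel c / fwd_rate J c)"
  defines "l \<equiv> (if improper c then l0 else min l0 ((1 - emptiness J c) / bwd_rate J c))"
  defines "c' \<equiv> c\<lparr>fwd_fuel := fwd_fuel c - l * fwd_rate J c, bwd_fuel := bwd_fuel c - l * bwd_rate J c\<rparr>"
  assumes c: "regular J c" and f: "0 < fwd_fuel c" and xy: "y < x"
    and e: "\<not> (bwd_doubles c > 0 \<and> emptiness J c \<ge> 1)"
  shows "0 < l" "l \<le> x - y" "regular J c'"
    and "leg (ringles J) l (need c) (surplus c) (need c') (surplus c')"
    and "need c' + 1 \<le> (need c + 1) * exp (2 * l)"
    and "ride_measure J K (x - l) y c' < ride_measure J K x y c"
proof -
  have r: "ringles J = 0 \<or> ringles J = 1" by (rule ringles_cases)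
  have fr: "1 \<le> fwd_rate J c" "fwd_rate J c \<le> 2 * real (fwd_doubles c) + 2"
    using r by (auto simp: fwd_rate_def)
  have l0: "0 < l0" "l0 \<le> x - y" "l0 * fwd_rate J c \<le> fwd_fuel c"
    using f xy fr by (auto simp: l0_def min_def field_simps)
  have br: "bwd_rate J c = 2 * real (bwd_doubles c) + real (ringles J)" "0 < bwd_rate J c"
      "emptiness J c < 1" "1 \<le> bwd_doubles c + ringles J" if "\<not> improper c"
    using that c e r by (auto simp: bwd_rate_def improper_def regular_def emptiness_def surplus_def)
  show l: "0 < l" using l0 br by (auto simp: l_def)
  show lxy: "l \<le> x - y" using l0 by (auto simp: l_def)
  have "l \<le> l0" by (auto simp: l_def)
  then have "l * fwd_rate J c \<le> l0 * fwd_rate J c" using fr by (intro mult_right_mono) auto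
  then have lf: "l * fwd_rate J c \<le> fwd_fuel c" using l0 by linarith
  have lb: "l * bwd_rate J c \<le> 1 - emptiness J c" if "\<not> improper c"
  proof -
    have "l * bwd_rate J c \<le> (1 - emptiness J c) / bwd_rate J c * bwd_rate J c"
      using br[OF that] that by (intro mult_right_mono) (auto simp: l_def)
    then show ?thesis using br[OF that] by simp
  qed
  have lf0: "0 \<le> l * fwd_rate J c" "0 \<le> l * bwd_rate J c"
    using l fr br by (auto simp: bwd_rate_def)
  have imp: "emptiness J c' = emptiness J c" "bwd_fuel c' = bwd_fuel c" if "improper c"
    using that by (simp_all add: c'_def emptiness_def bwd_rate_def)
  have prp: "emptiness J c' = emptiness J c + l * bwd_rate J c"
    by (simp add: c'_def emptiness_def)
  have e': "0 \<le> emptiness J c' \<and> emptiness J c' \<le> 1"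
    using imp prp lb lf0 c by (cases "improper c") (auto simp: regular_def)
  \<comment> \<open>For a proper sub-convoy, \<open>surplus\<close> is its number of jeeps, at least
    1, minus its emptiness, at most 1.\<close>
  have s': "0 \<le> surplus c'"
  proof (cases "improper c")
    case True
    then show ?thesis using c by (simp add: surplus_def regular_def c'_def bwd_rate_def)
  next
    case False
    have "surplus c' = real (bwd_doubles c + ringles J) - emptiness J c'"
      by (simp add: c'_def surplus_def emptiness_def)
    moreover have "1 \<le> real (bwd_doubles c + ringles J)" using br(4)[OF False] by linarith
    ultimately show ?thesis using e' by linarith
  qed
  show c': "regular J c'"
    using e' s' lf lf0 c by (simp add: regular_def c'_def)
  have N': "need c' = need c + l * fwd_rate J c" by (simp add: need_def c'_def)
  show "leg (ringles J) l (need c) (surplus c) (need c') (surplus c')"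
  proof -
    have "real (fwd_doubles c) \<le> need c" using c by (simp add: need_def regular_def)
    moreover have "need c' \<le> real (fwd_doubles c) + 1" using c' by (simp add: need_def regular_def c'_def)
    moreover have "surplus c = 0 \<and> surplus c' = 0 \<and> need c' = need c + (2 * real (fwd_doubles c) + 1 + real (ringles J)) * l \<or>
      1 \<le> bwd_doubles c + ringles J \<and> surplus c \<le> real (bwd_doubles c + ringles J) \<and>
      real (bwd_doubles c + ringles J) \<le> surplus c' + 1 \<and>
      need c' = need c + (2 * real (fwd_doubles c) + 1) * l \<and>
      surplus c' = surplus c - (2 * real (bwd_doubles c) + real (ringles J)) * l"
    proof (cases "improper c")
      case True
      then have "surplus c = 0" by (simp add: surplus_def improper_def)
      moreover have "surplus c' = 0" using True imp by (simp add: surplus_def improper_def c'_def)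
      ultimately show ?thesis using True N' by (simp add: fwd_rate_def mult.commute)
    next
      case False
      then show ?thesis using br[OF False] e' c N'
        by (auto simp: surplus_def emptiness_def regular_def fwd_rate_def c'_def mult.commute)
    qed
    ultimately show ?thesis unfolding leg_def by blast
  qed
  show "need c' + 1 \<le> (need c + 1) * exp (2 * l)"
  proof -
    have "l * fwd_rate J c \<le> l * (2 * (need c + 1))"
      using fr c l by (intro mult_left_mono) (auto simp: need_def regular_def)
    then have "need c' + 1 \<le> (need c + 1) * (1 + 2 * l)"
      unfolding N' by (simp add: algebra_simps)
    also have "\<dots> \<le> (need c + 1) * exp (2 * l)"
      using regular_need_nonneg[OF c] by (intro mult_left_mono exp_ge_add_one_self) auto
    finally show ?thesis .
  qed
  have mono: "improper c \<Longrightarrow> improper c'"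
    using imp by (simp add: improper_def c'_def)
  consider "l = x - y" | "fwd_fuel c' = 0" | "\<not> improper c" "emptiness J c' = 1"
  proof -
    have "l = x - y \<or> l = fwd_fuel c / fwd_rate J c \<or> \<not> improper c \<and> l = (1 - emptiness J c) / bwd_rate J c"
      unfolding l_def l0_def min_def by auto
    moreover have "fwd_fuel c' = 0" if "l = fwd_fuel c / fwd_rate J c"
      using fr that by (simp add: c'_def)
    moreover have "emptiness J c' = 1" if "\<not> improper c" "l = (1 - emptiness J c) / bwd_rate J c"
      using br[OF that(1)] that(2) prp by simp
    ultimately show thesis using that by blast
  qed
  then show "ride_measure J K (x - l) y c' < ride_measure J K x y c"
  proof cases
    case 1
    then show ?thesis using f e xy mono by (auto simp: ride_measure_def c'_def)
  next
    case 2
    then show ?thesis using f e xy mono l by (auto simp: ride_measure_def c'_def)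
  next
    case 3
    have "improper c'" if "bwd_doubles c = 0"
      using that 3 br[OF 3(1)] r by (auto simp: improper_def emptiness_def c'_def)
    then show ?thesis using 3 f e xy mono l by (auto simp: ride_measure_def c'_def)
  qed
qed

text \<open>The values just left of \<open>x\<close>, after its depot has been handled.\<close>

definition left_plan :: "task \<Rightarrow> real \<Rightarrow> real \<Rightarrow> real \<Rightarrow> bool" where
  "left_plan J x N B \<longleftrightarrow> (\<exists>N0 B0. plan J x N0 B0 \<and> N = need_left J x N0 B0 \<and> B = surplus_left J x N0 B0)"

lemma plan_imp_left_plan:
  "plan J x N B \<Longrightarrow> x \<notin> depots J \<Longrightarrow> left_plan J x N B"
  using plan_nonneg left_not_depot unfolding left_plan_def by metis

lemma fwd_create:
  assumes "regular J c" "fwd_fuel c \<le> 0"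
  shows "regular J (fwd_create 1 c)" "need (fwd_create 1 c) = need c" "surplus (fwd_create 1 c) = surplus c"
    and "real (fwd_doubles c) < need c + 1"
    and "fwd_doubles c \<le> K \<Longrightarrow> ride_measure J K x y (fwd_create 1 c) < ride_measure J K x y c"
  using assms
  by (auto simp: regular_def need_def surplus_def fwd_create_def emptiness_def ride_measure_def improper_def)

lemma bwd_cancel:
  assumes "regular J c" "bwd_doubles c > 0" "emptiness J c \<ge> 1"
  shows "regular J (bwd_cancel c)" "need (bwd_cancel c) = need c" "surplus (bwd_cancel c) = surplus c"
    and "ride_measure J K x y (bwd_cancel c) < ride_measure J K x y c"
  using assms
  by (auto simp: regular_def need_def surplus_def bwd_cancel_def emptiness_def ride_measure_def improper_def)

declare ride.simps [simp del]

text \<open>One equation for each branch, because rewriting with \<open>ride.simps\<close> itself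
  would loop.\<close>

lemma ride_create: "fwd_fuel c \<le> 0 \<Longrightarrow> ride J x y c = ride J x y (fwd_create 1 c)"
  by (rule trans[OF ride.simps]) (simp only: if_True)

lemma ride_stop: "\<not> fwd_fuel c \<le> 0 \<Longrightarrow> x \<le> y \<Longrightarrow> ride J x y c = c"
  by (rule trans[OF ride.simps]) (simp only: if_True if_False)

lemma ride_cancel:
  "\<not> fwd_fuel c \<le> 0 \<Longrightarrow> \<not> x \<le> y \<Longrightarrow> bwd_doubles c > 0 \<and> emptiness J c \<ge> 1 \<Longrightarrow>
    ride J x y c = ride J x y (bwd_cancel c)"
  by (rule trans[OF ride.simps]) (simp only: if_True if_False simp_thms)

lemma ride_on:
  assumes "\<not> fwd_fuel c \<le> 0" "\<not> x \<le> y" "\<not> (bwd_doubles c > 0 \<and> emptiness J c \<ge> 1)"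
    and "l0 = min (x - y) (fwd_fuel c / fwd_rate J c)"
    and "l = (if improper c then l0 else min l0 ((1 - emptiness J c) / bwd_rate J c))"
  shows "ride J x y c = ride J (x - l) y
    (c\<lparr>fwd_fuel := fwd_fuel c - l * fwd_rate J c, bwd_fuel := bwd_fuel c - l * bwd_rate J c\<rparr>)"
  unfolding assms(4,5) by (rule trans[OF ride.simps]) (simp only: assms(1-3) if_False Let_def)

text \<open>The quantity \<open>(need c + 1) * exp (2 * x)\<close> does not increase along the ride,
  so a single \<open>K\<close> serves for the measure throughout. The case \<open>x = y\<close> asks
  for the values right of \<open>y\<close>, since the depot at \<open>y\<close> is not handled by
  \<open>ride\<close>.\<close>

lemma ride_plan_aux:
  assumes "regular J c" "0 \<le> y" "y \<le> x" "depots J \<inter> {y<..<x} = {}"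
    and "if x = y then plan J x (need c) (surplus c) else left_plan J x (need c) (surplus c)"
    and "(need c + 1) * exp (2 * x) \<le> real K"
  shows "regular J (ride J x y c) \<and> plan J y (need (ride J x y c)) (surplus (ride J x y c))"
  using assms
proof (induction "ride_measure J K x y c" arbitrary: x c rule: less_induct)
  case less
  note c = less.prems(1)
  show ?case
  proof (cases "fwd_fuel c \<le> 0")
    case True
    \<comment> \<open>The truncated subtraction in the measure decreases only if a creation starts
      with at most \<open>K\<close> double jeeps.\<close>
    have "real (fwd_doubles c) < need c + 1" using fwd_create(4)[OF c True] .
    also have "\<dots> \<le> (need c + 1) * exp (2 * x)"
      using regular_need_nonneg[OF c] less.prems(2,3) by (simp add: mult_le_cancel_left1)
    finally have "fwd_doubles c \<le> K" using less.prems(6) by simp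
    from less.hyps[OF fwd_create(5)[OF c True this] fwd_create(1)[OF c True] less.prems(2-4)]
    have "regular J (ride J x y (fwd_create 1 c)) \<and>
      plan J y (need (ride J x y (fwd_create 1 c))) (surplus (ride J x y (fwd_create 1 c)))"
      using less.prems(5,6) by (simp only: fwd_create(2,3)[OF c True])
    moreover have "ride J x y c = ride J x y (fwd_create 1 c)"
      using True by (rule ride_create)
    ultimately show ?thesis by simp
  next
    case f: False
    show ?thesis
    proof (cases "x \<le> y")
      case True
      then have "ride J x y c = c" using f True by (intro ride_stop)
      then show ?thesis using True less.prems by simp
    next
      case xy: False
      show ?thesis
      proof (cases "bwd_doubles c > 0 \<and> emptiness J c \<ge> 1")
        case True
        then have e: "bwd_doubles c > 0" "emptiness J c \<ge> 1" by auto
        from less.hyps[OF bwd_cancel(4)[OF c e] bwd_cancel(1)[OF c e] less.prems(2-4)]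
        have "regular J (ride J x y (bwd_cancel c)) \<and>
          plan J y (need (ride J x y (bwd_cancel c))) (surplus (ride J x y (bwd_cancel c)))"
          using less.prems(5,6) by (simp only: bwd_cancel(2,3)[OF c e])
        moreover have "ride J x y c = ride J x y (bwd_cancel c)"
          using f xy True by (rule ride_cancel)
        ultimately show ?thesis by simp
      next
        case e: False
        define l0 where "l0 = min (x - y) (fwd_fuel c / fwd_rate J c)"
        define l where "l = (if improper c then l0 else min l0 ((1 - emptiness J c) / bwd_rate J c))"
        define c' where "c' = c\<lparr>fwd_fuel := fwd_fuel c - l * fwd_rate J c, bwd_fuel := bwd_fuel c - l * bwd_rate J c\<rparr>"
        have f': "0 < fwd_fuel c" and xy': "y < x" using f xy by auto
        note move = ride_move[OF c f' xy' e, folded l0_def, folded l_def, folded c'_def]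
        have eq: "ride J x y c = ride J (x - l) y c'"
          unfolding c'_def using f xy e l0_def l_def by (rule ride_on)
        have nodep: "depots J \<inter> {x - l<..<x} = {}" and nodep': "depots J \<inter> {y<..<x - l} = {}"
          using less.prems(4) move(1,2) by auto
        obtain N0 B0 where p0: "plan J x N0 B0" "need c = need_left J x N0 B0" "surplus c = surplus_left J x N0 B0"
          using less.prems(5) xy' by (auto simp: left_plan_def)
        have p: "plan J (x - l) (need c') (surplus c')"
          using move(1,2,4) less.prems(2) nodep unfolding p0(2,3)
          by (intro plan.step[OF p0(1)]) auto
        have "if x - l = y then plan J (x - l) (need c') (surplus c') else left_plan J (x - l) (need c') (surplus c')"
        proof (cases "x - l = y")
          case False
          then have "x - l \<notin> depots J" using less.prems(4) move(1,2) by auto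
          then show ?thesis using plan_imp_left_plan[OF p] False by simp
        qed (use p in simp)
        moreover have "(need c' + 1) * exp (2 * (x - l)) \<le> real K"
        proof -
          have "(need c' + 1) * exp (2 * (x - l)) \<le> (need c + 1) * exp (2 * l) * exp (2 * (x - l))"
            by (intro mult_right_mono move) auto
          also have "\<dots> = (need c + 1) * exp (2 * x)"
            by (simp add: mult_exp_exp algebra_simps)
          finally show ?thesis using less.prems(6) by linarith
        qed
        ultimately show ?thesis
          unfolding eq using less.prems(2) nodep' move(2) by (intro less.hyps[OF move(6) move(3)]) simp_all
      qed
    qed
  qed
qed

lemma ride_plan:
  assumes "regular J c" "0 \<le> y" "y \<le> x" "depots J \<inter> {y<..<x} = {}"
    and "if x = y then plan J x (need c) (surplus c) else left_plan J x (need c) (surplus c)"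
  shows "regular J (ride J x y c)" "plan J y (need (ride J x y c)) (surplus (ride J x y c))"
proof -
  obtain K where "(need c + 1) * exp (2 * x) \<le> real K" using real_arch_simple by blast
  from ride_plan_aux[OF assms this]
  show "regular J (ride J x y c)" "plan J y (need (ride J x y c)) (surplus (ride J x y c))" by auto
qed

text \<open>The test \<open>x \<in> set ps\<close> is for a depot at the oasis, which is still
  unhandled when the convoy starts there. Later the current position is a depot that has just been
  visited.\<close>

lemma tour_plan:
  assumes "regular J c" "0 < x" "sorted_wrt (>) ps"
    and "if x \<in> set ps then plan J x (need c) (surplus c) else left_plan J x (need c) (surplus c)"
    and "\<And>z. z \<in> depots J \<Longrightarrow> z < x \<Longrightarrow> z \<in> set ps"
    and "\<And>z. z \<in> set ps \<Longrightarrow> z \<in> depots J \<and> 0 < z \<and> z \<le> x \<and> 0 \<le> available J z \<and> 0 \<le> required J z"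
  shows "plan J 0 (need (tour J x ps c)) (surplus (tour J x ps c))"
  using assms
proof (induction ps arbitrary: x c)
  case Nil
  have "depots J \<inter> {0<..<x} = {}" using Nil.prems(5) by force
  then have "plan J 0 (need (ride J x 0 c)) (surplus (ride J x 0 c))"
    using Nil.prems by (intro ride_plan(2)) simp_all
  then show ?case by simp
next
  case (Cons p ps)
  have p: "p \<in> depots J" "0 < p" "p \<le> x" "0 \<le> available J p" "0 \<le> required J p"
    using Cons.prems(6)[of p] by auto
  define c1 where "c1 = ride J x p c"
  have "z \<le> p" if "z \<in> depots J" "z < x" for z
    using Cons.prems(5)[OF that] Cons.prems(3) by auto
  then have "depots J \<inter> {p<..<x} = {}" by (meson disjoint_iff greaterThanLessThan_iff not_le)
  moreover have "x \<notin> set ps" if "x \<noteq> p"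
    using Cons.prems(3) p that by auto
  then have "if x = p then plan J x (need c) (surplus c) else left_plan J x (need c) (surplus c)"
    using Cons.prems(4) by (cases "x = p") simp_all
  ultimately have c1: "regular J c1" "plan J p (need c1) (surplus c1)"
    using ride_plan[OF Cons.prems(1) less_imp_le[OF p(2)] p(3)] unfolding c1_def by blast+
  note v = visit_depot[OF c1(1) p(1,5,4)]
  have "p \<notin> set ps" using Cons.prems(3) by auto
  moreover have "left_plan J p (need (visit_depot J p c1)) (surplus (visit_depot J p c1))"
    unfolding left_plan_def v(2,3) using c1(2) by blast
  moreover have "z \<in> set ps" if "z \<in> depots J" "z < p" for z
    using Cons.prems(5)[of z] that p by auto
  moreover have "z \<in> depots J \<and> 0 < z \<and> z \<le> p \<and> 0 \<le> available J z \<and> 0 \<le> required J z"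
    if "z \<in> set ps" for z
    using Cons.prems(3) Cons.prems(6)[of z] that by auto
  moreover have "sorted_wrt (>) ps" using Cons.prems(3) by simp
  ultimately have "plan J 0 (need (tour J p ps (visit_depot J p c1))) (surplus (tour J p ps (visit_depot J p c1)))"
    using v(1) p(2) by (intro Cons.IH) simp_all
  then show ?case by (simp add: c1_def)
qed

text \<open>The bridge from the algorithm to the two halves: filling up the tanks at the border
  costs \<open>need\<close>, and the returned fuel is \<open>surplus\<close>.\<close>

lemma convoy_plan:
  assumes "0 < oasis J" "finite (depots J)" "depots J \<subseteq> {0<..oasis J}"
    and "\<And>x. x \<in> depots J \<Longrightarrow> 0 \<le> available J x"
    and "\<And>x. x \<in> depots J \<Longrightarrow> 0 \<le> required J x"
  obtains N B where "plan J 0 N B" "convoy_cost J = N - (if returning J then B else 0)"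
proof
  have s: "regular J convoy_start" "need convoy_start = 0" "surplus convoy_start = 0"
    using ringles_cases[of J]
    by (auto simp: regular_def convoy_start_def emptiness_def surplus_def need_def)
  have sw: "sorted_wrt (>) (rev (sorted_list_of_set (depots J)))"
    by (simp add: sorted_wrt_rev)
  show "plan J 0 (need (convoy_arrival J)) (surplus (convoy_arrival J))"
    unfolding convoy_arrival_def
    using assms sw s plan.start[of J] plan_imp_left_plan[OF plan.start[of J]]
    by (intro tour_plan) auto
  show "convoy_cost J = need (convoy_arrival J) - (if returning J then surplus (convoy_arrival J) else 0)"
    by (simp add: convoy_cost_def Let_def need_def surplus_def)
qed

section \<open>Optimality\<close>

text \<open>The tank content at the moment of passing \<open>z\<close>, counted positive outwards.
  The point \<open>z\<close> belongs to the left side, so leaving \<open>z\<close> outwards is a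
  crossing and arriving there from the left is not. Steps that do not change the position contribute
  0.\<close>

definition crossing_flow :: "real \<Rightarrow> jeep \<Rightarrow> jeep \<Rightarrow> real" where
  "crossing_flow z s s' =
     (if loc s \<le> z \<and> z < loc s' then tank s - (z - loc s)
      else if loc s' \<le> z \<and> z < loc s then - (tank s - (loc s - z)) else 0)"

definition out_cross :: "real \<Rightarrow> jeep \<Rightarrow> jeep \<Rightarrow> nat" where
  "out_cross z s s' = (if loc s \<le> z \<and> z < loc s' then 1 else 0)"

definition back_cross :: "real \<Rightarrow> jeep \<Rightarrow> jeep \<Rightarrow> nat" where
  "back_cross z s s' = (if loc s' \<le> z \<and> z < loc s then 1 else 0)"

locale schedule =
  fixes J :: task and ss :: "jeep list"
  assumes oasis_pos: "0 < oasis J"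
    and depots_range: "depots J \<subseteq> {0<..oasis J}"
    and available_nonneg: "x \<in> depots J \<Longrightarrow> 0 \<le> available J x"
    and alg: "normal_algorithm J ss"
begin

definition final :: nat where "final = length ss - 1"

definition outs :: "real \<Rightarrow> nat \<Rightarrow> nat" where
  "outs z k = (\<Sum>i<k. out_cross z (ss ! i) (ss ! Suc i))"

definition backs :: "real \<Rightarrow> nat \<Rightarrow> nat" where
  "backs z k = (\<Sum>i<k. back_cross z (ss ! i) (ss ! Suc i))"

text \<open>
  Net fuel transported in the first \<open>k\<close> steps from \<open>{..z}\<close> to \<open>{z<..}\<close> and from \<open>{..<z}\<close> to
  \<open>{z..}\<close>, respectively. For \<open>z = 0\<close>, the latter amounts to the fuel used from the border.
\<close>

definition flow :: "real \<Rightarrow> nat \<Rightarrow> real" where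
  "flow z k = (\<Sum>i<k. crossing_flow z (ss ! i) (ss ! Suc i))"

definition left_flow :: "real \<Rightarrow> nat \<Rightarrow> real" where
  "left_flow z k = flow z k + stock (ss ! k) z - avail J z + (if loc (ss ! k) = z then tank (ss ! k) else 0)"

lemma step: "k < final \<Longrightarrow> jeep_step J (ss ! k) (ss ! Suc k)"
  using alg by (auto simp: normal_algorithm_def final_def)

lemma first: "ss ! 0 = \<lparr>loc = 0, tank = 0, stock = avail J, spent = 0\<rparr>"
  using alg by (auto simp: normal_algorithm_def jeep_start_def hd_conv_nth avail_def fun_eq_iff)

lemma last_final: "last ss = ss ! final"
  using alg by (simp add: normal_algorithm_def final_def last_conv_nth)

lemma nonneg:
  "k \<le> final \<Longrightarrow> 0 \<le> tank (ss ! k) \<and> tank (ss ! k) \<le> 1 \<and> (\<forall>z. 0 \<le> stock (ss ! k) z) \<and>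
    0 \<le> loc (ss ! k) \<and> loc (ss ! k) \<le> oasis J"
proof (induction k)
  case 0
  then show ?case using available_nonneg oasis_pos by (auto simp: first avail_def)
next
  case (Suc k)
  then have IH: "0 \<le> tank (ss ! k)" "tank (ss ! k) \<le> 1" "\<And>z. 0 \<le> stock (ss ! k) z"
      "0 \<le> loc (ss ! k)" "loc (ss ! k) \<le> oasis J" by auto
  have "jeep_step J (ss ! k) (ss ! Suc k)" using Suc.prems step by simp
  then show ?case using IH by cases auto
qed

lemma outs_minus_backs:
  "0 \<le> z \<Longrightarrow> k \<le> final \<Longrightarrow> outs z k = backs z k + (if z < loc (ss ! k) then 1 else 0)"
proof (induction k)
  case 0
  then show ?case by (simp add: outs_def backs_def first)
next
  case (Suc k)
  then show ?case by (auto simp: outs_def backs_def out_cross_def back_cross_def)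
qed

lemma crossing_flow_bounds:
  assumes "k < final"
  shows "- real (back_cross z (ss ! k) (ss ! Suc k)) \<le> crossing_flow z (ss ! k) (ss ! Suc k)"
    and "crossing_flow z (ss ! k) (ss ! Suc k) \<le> real (out_cross z (ss ! k) (ss ! Suc k))"
proof -
  have "0 \<le> tank (ss ! k)" "tank (ss ! k) \<le> 1" using nonneg[of k] assms by auto
  with step[OF assms]
  show "- real (back_cross z (ss ! k) (ss ! Suc k)) \<le> crossing_flow z (ss ! k) (ss ! Suc k)"
    "crossing_flow z (ss ! k) (ss ! Suc k) \<le> real (out_cross z (ss ! k) (ss ! Suc k))"
    by (cases; auto simp: crossing_flow_def out_cross_def back_cross_def)+
qed

text \<open>An outward passage carries at most one tankload, and a return passage never adds to the
  net flow.\<close>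

lemma flow_le_outs: "k \<le> final \<Longrightarrow> flow z k \<le> real (outs z k)"
  unfolding flow_def outs_def of_nat_sum by (intro sum_mono crossing_flow_bounds) auto

lemma flow_decrease_le_backs:
  assumes "j \<le> final" "k \<le> j"
  shows "flow z k - flow z j \<le> real (backs z j) - real (backs z k)"
proof -
  have "{..<j} = {..<k} \<union> {k..<j}" using assms by auto
  then have split: "sum f {..<j} = sum f {..<k} + sum f {k..<j}" for f :: "nat \<Rightarrow> real"
    by (simp add: sum.union_disjoint ivl_disj_int)
  have "(\<Sum>i=k..<j. - real (back_cross z (ss ! i) (ss ! Suc i))) \<le>
      (\<Sum>i=k..<j. crossing_flow z (ss ! i) (ss ! Suc i))"
    using assms by (intro sum_mono crossing_flow_bounds) auto
  then show ?thesis
    unfolding flow_def backs_def of_nat_sum split by (simp add: sum_negf)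
qed

lemma outs_mono: "k \<le> j \<Longrightarrow> outs z k \<le> outs z j"
  unfolding outs_def by (intro sum_mono2) auto

text \<open>Every crossing of an interval without stops burns its length, whatever the direction.\<close>

lemma flow_across:
  assumes "y < x" "0 \<le> y" and gap: "\<And>k. k \<le> final \<Longrightarrow> loc (ss ! k) \<notin> {y<..<x}"
  shows "k \<le> final \<Longrightarrow> flow y k = left_flow x k + (x - y) * real (outs y k + backs y k)"
proof (induction k)
  case 0
  then show ?case using assms by (simp add: flow_def left_flow_def outs_def backs_def first)
next
  case (Suc k)
  define s where "s = ss ! k"
  define s' where "s' = ss ! Suc k"
  have l: "loc s \<le> y \<or> x \<le> loc s" "loc s' \<le> y \<or> x \<le> loc s'"
    using gap[of k] gap[of "Suc k"] Suc.prems by (auto simp: s_def s'_def)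
  have "crossing_flow y s s' =
      crossing_flow x s s' + (stock s' x + (if loc s' = x then tank s' else 0))
      - (stock s x + (if loc s = x then tank s else 0))
      + (x - y) * (real (out_cross y s s') + real (back_cross y s s'))"
  proof -
    have "jeep_step J s s'" using Suc.prems step by (simp add: s_def s'_def)
    then show ?thesis using l assms(1,2)
      by cases (auto simp: crossing_flow_def out_cross_def back_cross_def)
  qed
  then show ?case using Suc
    unfolding flow_def left_flow_def outs_def backs_def s_def s'_def by (simp add: algebra_simps)
qed

lemma flow_oasis: "k \<le> final \<Longrightarrow> flow (oasis J) k = 0"
proof -
  assume k: "k \<le> final"
  have "crossing_flow (oasis J) (ss ! i) (ss ! Suc i) = 0" if "i < k" for i
    using nonneg[of i] nonneg[of "Suc i"] that k by (auto simp: crossing_flow_def)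
  then show ?thesis by (simp add: flow_def)
qed

lemma left_flow_border: "k \<le> final \<Longrightarrow> left_flow 0 k = spent (ss ! k)"
proof (induction k)
  case 0
  then show ?case by (simp add: flow_def left_flow_def first)
next
  case (Suc k)
  define s where "s = ss ! k"
  define s' where "s' = ss ! Suc k"
  have l: "0 \<le> loc s" "0 \<le> loc s'"
    using nonneg[of k] nonneg[of "Suc k"] Suc.prems by (auto simp: s_def s'_def)
  have "jeep_step J s s'" using Suc.prems step by (simp add: s_def s'_def)
  then have "spent s' - spent s =
      crossing_flow 0 s s' + (stock s' 0 + (if loc s' = 0 then tank s' else 0))
      - (stock s 0 + (if loc s = 0 then tank s else 0))"
    using l by cases (auto simp: crossing_flow_def)
  then show ?case using Suc
    unfolding flow_def left_flow_def s_def s'_def by simp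
qed

lemma spent_mono:
  assumes "\<not> returning J"
  shows "j \<le> final \<Longrightarrow> k \<le> j \<Longrightarrow> spent (ss ! k) \<le> spent (ss ! j)"
proof (induction j)
  case (Suc j)
  have "jeep_step J (ss ! j) (ss ! Suc j)" using Suc.prems step by simp
  then have "spent (ss ! j) \<le> spent (ss ! Suc j)" using assms by cases auto
  then show ?case using Suc by (cases "k = Suc j") auto
qed simp

lemma flow_first_crossing:
  assumes "y < x" "0 \<le> y" and gap: "\<And>k. k \<le> final \<Longrightarrow> loc (ss ! k) \<notin> {y<..<x}" and "x \<le> oasis J"
  obtains k where "k \<le> final" "x - y \<le> flow y k"
proof -
  have *: "k \<le> final \<Longrightarrow> loc (ss ! k) \<le> y \<and> flow y k = 0 \<or> (\<exists>j\<le>k. x - y \<le> flow y j)" for k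
  proof (induction k)
    case 0
    then show ?case using assms by (simp add: flow_def first)
  next
    case (Suc k)
    from Suc consider "loc (ss ! k) \<le> y" "flow y k = 0" | "\<exists>j\<le>k. x - y \<le> flow y j" by auto
    then show ?case
    proof cases
      case 1
      have "jeep_step J (ss ! k) (ss ! Suc k)" using Suc.prems step by simp
      then have "x \<le> loc (ss ! Suc k) \<Longrightarrow> x - y \<le> crossing_flow y (ss ! k) (ss ! Suc k)"
        using 1 \<open>y < x\<close> by cases (auto simp: crossing_flow_def)
      moreover have "loc (ss ! Suc k) \<le> y \<Longrightarrow> crossing_flow y (ss ! k) (ss ! Suc k) = 0"
        using 1 by (simp add: crossing_flow_def)
      moreover have "flow y (Suc k) = crossing_flow y (ss ! k) (ss ! Suc k)"
        using 1 by (simp add: flow_def)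
      moreover have "loc (ss ! Suc k) \<le> y \<or> x \<le> loc (ss ! Suc k)"
        using gap[OF Suc.prems] by auto
      ultimately show ?thesis by auto
    next
      case 2
      then show ?thesis using le_Suc_eq by blast
    qed
  qed
  obtain k where "k < length ss" "loc (ss ! k) = oasis J"
    using alg by (auto simp: normal_algorithm_def in_set_conv_nth)
  then have "k \<le> final" "loc (ss ! k) = oasis J" by (auto simp: final_def)
  with *[of k] assms(1,4) obtain j where "j \<le> k" "x - y \<le> flow y j" by auto
  with \<open>k \<le> final\<close> show thesis using that[of j] by simp
qed

section \<open>Lower bounds on the net flows of an arbitrary schedule\<close>

definition dominates :: "(nat \<Rightarrow> real) \<Rightarrow> real \<Rightarrow> real \<Rightarrow> bool" where
  "dominates F N B \<longleftrightarrow> (\<exists>k\<le>final. N \<le> F k) \<and> N - B \<le> F final"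

text \<open>By the time of the peak, \<open>a + 1\<close> outward passages, and therefore at least
  \<open>a\<close> return passages, have taken place, which yields \<open>N'\<close>. For the final
  value, either the total number of passages is large enough to burn what the leg prescribes, or too
  few return passages remain after the peak to bring back more than \<open>B'\<close>.\<close>

lemma dominates_across_gap:
  assumes y: "y < x" "0 \<le> y" "x \<le> oasis J"
    and gap: "\<And>k. k \<le> final \<Longrightarrow> loc (ss ! k) \<notin> {y<..<x}"
    and leg: "leg (ringles J) (x - y) N B N' B'"
    and dom: "dominates (left_flow x) N B"
  shows "dominates (flow y) N' B'"
proof -
  have across: "flow y k = left_flow x k + (x - y) * real (outs y k + backs y k)" if "k \<le> final" for k
    using y(1,2) gap that by (rule flow_across)
  define l where "l = x - y"
  have l: "0 < l" using y by (simp add: l_def)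
  obtain a b where a: "real a \<le> N" "N' \<le> real a + 1"
    and ab: "B = 0 \<and> B' = 0 \<and> N' = N + (2 * real a + 1 + real (ringles J)) * l \<or>
      1 \<le> b + ringles J \<and> B \<le> real (b + ringles J) \<and> real (b + ringles J) \<le> B' + 1 \<and>
      N' = N + (2 * real a + 1) * l \<and> B' = B - (2 * real b + real (ringles J)) * l"
    using leg unfolding leg_def l_def by blast
  have "\<exists>k\<le>final. a + 1 \<le> outs y k \<and> N + (2 * real a + 1) * l \<le> flow y k"
  proof -
    obtain k0 where k0: "k0 \<le> final" "N \<le> left_flow x k0" using dom by (auto simp: dominates_def)
    obtain k1 where k1: "k1 \<le> final" "l \<le> flow y k1"
      using flow_first_crossing[OF y(1,2) gap y(3)] unfolding l_def by metis
    have "0 < flow y k1" using k1 l by linarith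
    then have o1: "1 \<le> outs y k1" using flow_le_outs[OF k1(1), of y] by linarith
    show ?thesis
    proof (cases "outs y k0 = 0")
      \<comment> \<open>If nothing has crossed by the time that \<open>N\<close> is attained at
        \<open>x\<close>, then \<open>N\<close> is 0, and the first crossing is taken as the time of
        the peak at \<open>y\<close>.\<close>
      case True
      have "left_flow x k0 \<le> 0"
        using across[OF k0(1)] flow_le_outs[OF k0(1), of y] True l
        by (simp add: l_def) (smt (verit) mult_nonneg_nonneg of_nat_0_le_iff)
      then have "N \<le> 0" "a = 0" using k0 a by auto
      then show ?thesis using k1 o1 by (intro exI[of _ k1]) auto
    next
      case False
      have A: "flow y k0 = left_flow x k0 + l * (real (outs y k0) + real (backs y k0))"
        using across[OF k0(1)] by (simp add: l_def)
      have "0 < l * (real (outs y k0) + real (backs y k0))" using False l by simp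
      then have "real a < real (outs y k0)" using A k0 a flow_le_outs[OF k0(1), of y] by linarith
      then have o: "a + 1 \<le> outs y k0" by simp
      moreover have "outs y k0 \<le> backs y k0 + 1" using outs_minus_backs[OF y(2) k0(1)] by auto
      ultimately have "2 * real a + 1 \<le> real (outs y k0) + real (backs y k0)" by linarith
      then have "l * (2 * real a + 1) \<le> l * (real (outs y k0) + real (backs y k0))"
        using l by (intro mult_left_mono) auto
      then have "N + (2 * real a + 1) * l \<le> flow y k0" using A k0 by (simp add: mult.commute)
      then show ?thesis using o k0 by blast
    qed
  qed
  then obtain k where k: "k \<le> final" "a + 1 \<le> outs y k" "N + (2 * real a + 1) * l \<le> flow y k"
    by blast
  have r: "ringles J = 0 \<or> ringles J = 1" by (rule ringles_cases)
  have fin: "outs y final + ringles J = backs y final + 1"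
    using outs_minus_backs[OF y(2) order_refl] alg y
    by (auto simp: normal_algorithm_def last_final[symmetric] ringles_def)
  have of: "a + 1 \<le> outs y final" using k outs_mono[OF k(1), of y] by linarith
  have F: "flow y final = left_flow x final + l * (real (outs y final) + real (backs y final))"
    using across[OF order_refl] by (simp add: l_def)
  have enough: "N - B + c * l \<le> flow y final" if "c \<le> real (outs y final) + real (backs y final)" for c
  proof -
    have "l * c \<le> l * (real (outs y final) + real (backs y final))"
      using that l by (intro mult_left_mono) auto
    then show ?thesis using F dom by (simp add: dominates_def mult.commute)
  qed
  from ab show ?thesis
  proof (elim disjE conjE)
    assume i: "B = 0" "B' = 0" "N' = N + (2 * real a + 1 + real (ringles J)) * l"
    have "2 * real a + 1 + real (ringles J) \<le> real (outs y final) + real (backs y final)"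
      using of fin r by auto
    then have "N' \<le> flow y final" using enough i by fastforce
    then show ?thesis using i by (auto simp: dominates_def)
  next
    assume p: "1 \<le> b + ringles J" "B \<le> real (b + ringles J)" "real (b + ringles J) \<le> B' + 1"
      "N' = N + (2 * real a + 1) * l" "B' = B - (2 * real b + real (ringles J)) * l"
    have "N' - B' \<le> flow y final"
    proof (cases "a + b + 1 \<le> outs y final")
      case True
      then have "2 * real a + 2 * real b + 1 + real (ringles J) \<le> real (outs y final) + real (backs y final)"
        using fin r by auto
      from enough[OF this] show ?thesis unfolding p(4,5) by (simp add: algebra_simps)
    next
      \<comment> \<open>There are at most \<open>a + b\<close> outward passages altogether. Since at
        least \<open>a\<close> return passages precede time \<open>k\<close>, at most
        \<open>b + ringles J - 1\<close> follow. Each brings back at most one tankload, and the leg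
        bounds this number by \<open>B'\<close>.\<close>
      case False
      have "a \<le> backs y k" using k outs_minus_backs[OF y(2) k(1)] by (auto split: if_splits)
      moreover have "flow y k - flow y final \<le> real (backs y final) - real (backs y k)"
        using flow_decrease_le_backs[OF order_refl k(1)] .
      moreover have "real (backs y final) + 1 \<le> real a + real b + real (ringles J)"
        using False fin by linarith
      ultimately show ?thesis using k(3) p(3,4) by simp
    qed
    then show ?thesis using k p(4) by (auto simp: dominates_def)
  qed
qed

lemma left_flow_ge: "k \<le> final \<Longrightarrow> flow x k - avail J x \<le> left_flow x k"
  using nonneg[of k] by (simp add: left_flow_def)

text \<open>Induction on the number of positions in the gap where the schedule stops: the leg is cut
  at the rightmost one. There is no depot there initially, so fuel stored there or in the tank can
  only make \<open>left_flow\<close> larger than \<open>flow\<close>.\<close>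

lemma dominates_leg:
  assumes "y < x" "0 \<le> y" "x \<le> oasis J" "depots J \<inter> {y<..<x} = {}"
    and "leg (ringles J) (x - y) N B N' B'" "dominates (left_flow x) N B"
  shows "dominates (flow y) N' B'"
  using assms
proof (induction "card ((\<lambda>k. loc (ss ! k)) ` {..final} \<inter> {y<..<x})" arbitrary: x N B rule: less_induct)
  case less
  let ?L = "\<lambda>x. (\<lambda>k. loc (ss ! k)) ` {..final} \<inter> {y<..<x}"
  show ?case
  proof (cases "?L x = {}")
    case True
    then show ?thesis using less.prems by (intro dominates_across_gap[of y x N B]) auto
  next
    case False
    define z where "z = Max (?L x)"
    have fin: "finite (?L x)" by simp
    have zL: "z \<in> ?L x" unfolding z_def using fin False by (rule Max_in)
    then have z: "y < z" "z < x" by auto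
    have max: "loc (ss ! k) \<notin> {z<..<x}" if "k \<le> final" for k
      using Max_ge[OF fin, of "loc (ss ! k)"] that z by (force simp: z_def[symmetric])
    obtain N1 B1 where leg1: "leg (ringles J) (x - z) N B N1 B1"
      and leg2: "leg (ringles J) (z - y) N1 B1 N' B'"
      using leg_split[OF less.prems(5), of "x - z"] z by auto
    have "dominates (flow z) N1 B1"
      using z less.prems max leg1 by (intro dominates_across_gap[of z x N B]) auto
    moreover have "avail J z = 0" using z less.prems(4) by (auto simp: avail_def)
    ultimately have "dominates (left_flow z) N1 B1"
      unfolding dominates_def using left_flow_ge[of _ z] by (metis diff_zero order_trans order_refl)
    moreover have "card (?L z) < card (?L x)"
      using fin z zL by (intro psubset_card_mono) auto
    ultimately show ?thesis
      using z less.prems leg2 by (intro less.hyps[of z N1 B1]) auto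
  qed
qed

text \<open>Each term of \<open>need_left\<close> has its own witness in time: the start, the time
  of the old peak, and the end.\<close>

lemma dominates_visit:
  assumes "dominates (flow x) N B"
  shows "dominates (left_flow x) (need_left J x N B) (surplus_left J x N B)"
proof -
  obtain k where k: "k \<le> final" "N \<le> flow x k" "N - B \<le> flow x final"
    using assms by (auto simp: dominates_def)
  have "req J x \<le> stock (ss ! final) x"
    using alg nonneg[OF order_refl] by (auto simp: normal_algorithm_def last_final req_def)
  then have f: "N - B + req J x - avail J x \<le> left_flow x final"
    using k nonneg[of final] by (simp add: left_flow_def)
  have "N - avail J x \<le> left_flow x k" using k left_flow_ge[of k x] by linarith
  moreover have "left_flow x 0 \<ge> 0" by (simp add: left_flow_def flow_def first)
  ultimately have "\<exists>k\<le>final. need_left J x N B \<le> left_flow x k"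
    using f k(1) unfolding need_left_def max_def by auto
  then show ?thesis using f by (simp add: dominates_def surplus_left_def)
qed

lemma dominates_plan: "plan J x N B \<Longrightarrow> dominates (flow x) N B"
proof (induction rule: plan.induct)
  case start
  then show ?case by (auto simp: dominates_def flow_oasis)
next
  case (step x N B y N' B')
  then show ?case
    using plan_range[OF step.hyps(1)] oasis_pos dominates_visit
    by (intro dominates_leg[of y x]) auto
qed

text \<open>At the border, \<open>left_flow\<close> is the fuel spent. If fuel cannot be returned,
  the amount spent never falls again after the peak; otherwise the bound on the final value is
  used.\<close>

lemma plan_le_cost:
  assumes "plan J 0 N B"
  shows "N - (if returning J then B else 0) \<le> normal_cost ss"
proof -
  have "0 \<notin> depots J" using depots_range by auto
  then have "dominates (left_flow 0) N B"
    using dominates_visit[OF dominates_plan[OF assms]] plan_nonneg[OF assms] by (simp add: left_not_depot)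
  then obtain k where k: "k \<le> final" "N \<le> spent (ss ! k)" "N - B \<le> spent (ss ! final)"
    by (auto simp: dominates_def left_flow_border)
  then show ?thesis
    using spent_mono[of final k] by (auto simp: normal_cost_def last_final)
qed

end

section \<open>Execution as a normal algorithm\<close>

abbreviation reach :: "task \<Rightarrow> jeep \<Rightarrow> jeep \<Rightarrow> bool" where
  "reach J \<equiv> (jeep_step J)\<^sup>*\<^sup>*"

text \<open>Between two phases the tank is unloaded into the local stock, so only the position, the
  stock and the fuel spent have to be tracked.\<close>

definition parked :: "real \<Rightarrow> (real \<Rightarrow> real) \<Rightarrow> real \<Rightarrow> jeep" where
  "parked x \<sigma> e = \<lparr>loc = x, tank = 0, stock = \<sigma>, spent = e\<rparr>"

definition reach_via_oasis :: "task \<Rightarrow> jeep \<Rightarrow> jeep \<Rightarrow> bool" where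
  "reach_via_oasis J s t \<longleftrightarrow> (\<exists>m. reach J s m \<and> loc m = oasis J \<and> reach J m t)"

lemma reach_via_oasis_trans:
  "reach J s t \<Longrightarrow> reach_via_oasis J t u \<Longrightarrow> reach_via_oasis J s u"
  "reach_via_oasis J s t \<Longrightarrow> reach J t u \<Longrightarrow> reach_via_oasis J s u"
  unfolding reach_via_oasis_def by (meson rtranclp_trans)+

lemma reach_transport:
  assumes "0 \<le> x" "x \<le> oasis J" "x \<noteq> y" "\<bar>x - y\<bar> \<le> t" "t \<le> 1" "t \<le> \<sigma> y"
  shows "reach J (parked y \<sigma> e) (parked x (\<sigma>(y := \<sigma> y - t, x := \<sigma> x + (t - \<bar>x - y\<bar>))) e)"
proof -
  define s1 where "s1 = \<lparr>loc = y, tank = t, stock = \<sigma>(y := \<sigma> y - t), spent = e\<rparr>"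
  define s2 where "s2 = \<lparr>loc = x, tank = t - \<bar>x - y\<bar>, stock = \<sigma>(y := \<sigma> y - t), spent = e\<rparr>"
  have "jeep_step J (parked y \<sigma> e) s1"
    using assms jeep_step.load[of t "parked y \<sigma> e" J] by (simp add: parked_def s1_def)
  moreover have "jeep_step J s1 s2"
    using assms jeep_step.drive[of x J s1] by (simp add: s1_def s2_def)
  moreover have "jeep_step J s2 (parked x (\<sigma>(y := \<sigma> y - t, x := \<sigma> x + (t - \<bar>x - y\<bar>))) e)"
    using assms jeep_step.unload[of "t - \<bar>x - y\<bar>" s2 J] by (simp add: parked_def s2_def)
  ultimately show ?thesis by (meson converse_rtranclp_into_rtranclp rtranclp.rtrancl_refl)
qed

lemma reach_shuttle:
  assumes "0 \<le> x" "x \<le> oasis J" "0 \<le> y" "y \<le> oasis J" "x \<noteq> y" "2 * \<bar>x - y\<bar> \<le> t" "t \<le> 1" "t \<le> \<sigma> y"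
  shows "reach J (parked y \<sigma> e) (parked y (\<sigma>(y := \<sigma> y - t, x := \<sigma> x + (t - 2 * \<bar>x - y\<bar>))) e)"
proof -
  have t: "0 \<le> t" "\<bar>x - y\<bar> \<le> t" by (rule order_trans[OF _ assms(6)]; simp)+
  define s1 where "s1 = \<lparr>loc = y, tank = t, stock = \<sigma>(y := \<sigma> y - t), spent = e\<rparr>"
  define s2 where "s2 = \<lparr>loc = x, tank = t - \<bar>x - y\<bar>, stock = \<sigma>(y := \<sigma> y - t), spent = e\<rparr>"
  define s3 where "s3 = \<lparr>loc = x, tank = \<bar>x - y\<bar>,
    stock = \<sigma>(y := \<sigma> y - t, x := \<sigma> x + (t - 2 * \<bar>x - y\<bar>)), spent = e\<rparr>"
  have "jeep_step J (parked y \<sigma> e) s1"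
    using assms t jeep_step.load[of t "parked y \<sigma> e" J] by (simp add: parked_def s1_def)
  moreover have "jeep_step J s1 s2"
    using assms t jeep_step.drive[of x J s1] by (simp add: s1_def s2_def)
  moreover have "jeep_step J s2 s3"
    using assms t jeep_step.unload[of "t - 2 * \<bar>x - y\<bar>" s2 J] by (simp add: s3_def s2_def)
  moreover have "jeep_step J s3 (parked y (\<sigma>(y := \<sigma> y - t, x := \<sigma> x + (t - 2 * \<bar>x - y\<bar>))) e)"
    using assms t jeep_step.drive[of y J s3] by (simp add: parked_def s3_def abs_minus_commute)
  ultimately show ?thesis by (meson converse_rtranclp_into_rtranclp rtranclp.rtrancl_refl)
qed

text \<open>\<open>a\<close> shuttles with a full tank are followed by one passage with the
  remaining \<open>N - a\<close>. The two bounds leave at least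
  \<open>(2 * a + 1) * \<bar>x - y\<bar>\<close> for this last passage and make that amount at most
  1, so that every single trip is within the range of a tank.\<close>

lemma reach_shuttles:
  assumes "0 \<le> x" "x \<le> oasis J" "0 \<le> y" "y \<le> oasis J" "x \<noteq> y"
    and "N \<le> real a + 1" "real a \<le> N - (2 * real a + 1) * \<bar>x - y\<bar>" "N \<le> \<sigma> y"
  shows "reach J (parked y \<sigma> e)
    (parked x (\<sigma>(y := \<sigma> y - N, x := \<sigma> x + (N - (2 * real a + 1) * \<bar>x - y\<bar>))) e)"
  using assms(6-8)
proof (induction a arbitrary: N \<sigma>)
  case 0
  have eq: "(2 * real 0 + 1) * \<bar>x - y\<bar> = \<bar>x - y\<bar>" by simp
  show ?case unfolding eq using 0 assms(1-5) by (intro reach_transport) auto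
next
  case (Suc a)
  define l where "l = \<bar>x - y\<bar>"
  have l: "0 \<le> real a * l" by (simp add: l_def)
  have D: "real a + 1 \<le> N - (2 * (real a * l) + 3 * l)"
    using Suc.prems(2) by (simp add: l_def[symmetric] algebra_simps)
  then have l2: "2 * l \<le> 1" using Suc.prems(1) l by simp
  have "1 \<le> N" using Suc.prems(2) by (smt (verit) l_def abs_ge_zero mult_nonneg_nonneg of_nat_0_le_iff of_nat_Suc)
  define \<sigma>1 where "\<sigma>1 = \<sigma>(y := \<sigma> y - 1, x := \<sigma> x + (1 - 2 * l))"
  have r1: "reach J (parked y \<sigma> e) (parked y \<sigma>1 e)"
    unfolding \<sigma>1_def l_def using assms(1-5) l2 Suc.prems(3) \<open>1 \<le> N\<close>
    by (intro reach_shuttle) (simp_all add: l_def)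
  have r2: "reach J (parked y \<sigma>1 e)
      (parked x (\<sigma>1(y := \<sigma>1 y - (N - 1), x := \<sigma>1 x + (N - 1 - (2 * real a + 1) * l))) e)"
    unfolding l_def
  proof (rule Suc.IH)
    show "N - 1 \<le> real a + 1" using Suc.prems(1) by simp
    have "real a \<le> N - 1 - (2 * (real a * l) + l)" using D l_def by linarith
    then show "real a \<le> N - 1 - (2 * real a + 1) * \<bar>x - y\<bar>"
      by (simp add: l_def[symmetric] algebra_simps)
    show "N - 1 \<le> \<sigma>1 y" using Suc.prems(3) assms(5) by (simp add: \<sigma>1_def)
  qed
  have eq: "\<sigma>1(y := \<sigma>1 y - (N - 1), x := \<sigma>1 x + (N - 1 - (2 * real a + 1) * l)) =
      \<sigma>(y := \<sigma> y - N, x := \<sigma> x + (N - (2 * real (Suc a) + 1) * l))"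
    using assms(5) by (auto simp: \<sigma>1_def fun_eq_iff algebra_simps)
  show ?case
    using rtranclp_trans[OF r1 r2] unfolding eq unfolding l_def .
qed

text \<open>
  The tour beyond \<open>x\<close> is interrupted at \<open>x\<close>, at a moment that the surplus \<open>B\<close> is available there, to
  allow carrying that surplus back and doing anything with the fuel on \<open>{..x}\<close>. The reserve \<open>w\<close> is what
  the remaining part of the tour takes from \<open>x\<close>. For a round trip, that part is empty.
\<close>

definition feasible :: "task \<Rightarrow> real \<Rightarrow> real \<Rightarrow> real \<Rightarrow> bool" where
  "feasible J x N B \<longleftrightarrow>
    (\<forall>\<sigma> e. N \<le> \<sigma> x \<longrightarrow> (\<forall>z>x. \<sigma> z = avail J z) \<longrightarrow>
      (\<exists>\<tau> w. 0 \<le> w \<and> reach J (parked x \<sigma> e) (parked x \<tau> e) \<and>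
        (round_trip J \<longrightarrow> reach_via_oasis J (parked x \<sigma> e) (parked x \<tau> e)) \<and>
        \<tau> x = \<sigma> x - N + B + w \<and> (\<forall>z<x. \<tau> z = \<sigma> z) \<and>
        (\<forall>\<sigma>' e'. w \<le> \<sigma>' x \<longrightarrow> (\<forall>z>x. \<sigma>' z = \<tau> z) \<longrightarrow>
          (\<exists>\<tau>'. reach J (parked x \<sigma>' e') (parked (if round_trip J then x else oasis J) \<tau>' e') \<and>
            \<tau>' x = \<sigma>' x - w \<and> (\<forall>z<x. \<tau>' z = \<sigma>' z) \<and> (\<forall>z>x. req J z \<le> \<tau>' z)))))"

lemma feasible_step:
  assumes x: "feasible J x N0 B0" and y: "0 \<le> y" "y < x" "x \<le> oasis J"
    and gap: "depots J \<inter> {y<..<x} = {}" and req: "0 \<le> req J x"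
    and leg: "leg (ringles J) (x - y) (need_left J x N0 B0) (surplus_left J x N0 B0) N B"
  shows "feasible J y N B"
proof -
  define l where "l = x - y"
  define N1 where "N1 = need_left J x N0 B0"
  define B1 where "B1 = surplus_left J x N0 B0"
  have l: "0 < l" "\<bar>x - y\<bar> = l" "\<bar>y - x\<bar> = l" using y by (auto simp: l_def)
  obtain a b where a: "real a \<le> N1" "N \<le> real a + 1"
    and ab: "B1 = 0 \<and> B = 0 \<and> N = N1 + (2 * real a + 1 + real (ringles J)) * l \<or>
      1 \<le> b + ringles J \<and> B1 \<le> real (b + ringles J) \<and> real (b + ringles J) \<le> B + 1 \<and>
      N = N1 + (2 * real a + 1) * l \<and> B = B1 - (2 * real b + real (ringles J)) * l"
    using leg unfolding leg_def l_def N1_def B1_def by blast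
  \<comment> \<open>The fuel that arrives at \<open>x\<close>. It exceeds \<open>N1\<close> only in
    the improper case of a round trip, by the distance \<open>l\<close>: fuel for the return passage
    of the empty ringle jeep.\<close>
  define D where "D = N - (2 * real a + 1) * l"
  have al: "0 \<le> real a * l" "0 \<le> real b * l" using l by simp_all
  have D: "N1 \<le> D" using ab l by (auto simp: D_def algebra_simps)
  have l1: "l \<le> 1" using D a al by (simp add: D_def algebra_simps)
  have N1: "N0 \<le> avail J x + N1" "avail J x + N1 - N0 + B0 = req J x + B1"
    by (auto simp: N1_def B1_def need_left_def surplus_left_def)
  have B1: "0 \<le> B1" by (simp add: B1_def surplus_left_nonneg)
  have z0: "avail J z = 0" "req J z = 0" if "y < z" "z < x" for z
    using gap that by (auto simp: avail_def req_def)
  have forward: "\<exists>\<tau> w. 0 \<le> w \<and> reach J (parked y \<sigma> e) (parked x \<tau> e) \<and>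
      (round_trip J \<longrightarrow> reach_via_oasis J (parked y \<sigma> e) (parked x \<tau> e)) \<and>
      \<tau> x = req J x + B1 + (D - N1) + w \<and> \<tau> y = \<sigma> y - N \<and> (\<forall>z<y. \<tau> z = \<sigma> z) \<and>
      (\<forall>z. y < z \<longrightarrow> z < x \<longrightarrow> \<tau> z = 0) \<and>
      (\<forall>\<sigma>' e'. w \<le> \<sigma>' x \<longrightarrow> (\<forall>z>x. \<sigma>' z = \<tau> z) \<longrightarrow>
        (\<exists>\<tau>'. reach J (parked x \<sigma>' e') (parked (if round_trip J then x else oasis J) \<tau>' e') \<and>
          \<tau>' x = \<sigma>' x - w \<and> (\<forall>z<x. \<tau>' z = \<sigma>' z) \<and> (\<forall>z>x. req J z \<le> \<tau>' z)))"
    if \<sigma>: "N \<le> \<sigma> y" "\<forall>z>y. \<sigma> z = avail J z" for \<sigma> e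
  proof -
    define \<sigma>1 where "\<sigma>1 = \<sigma>(y := \<sigma> y - N, x := \<sigma> x + D)"
    have r1: "reach J (parked y \<sigma> e) (parked x \<sigma>1 e)"
      unfolding \<sigma>1_def D_def l(2)[symmetric]
      using y a D \<sigma>(1) by (intro reach_shuttles) (auto simp: D_def l)
    have "N0 \<le> \<sigma>1 x" using N1(1) D \<sigma>(2) y by (simp add: \<sigma>1_def)
    moreover have "\<forall>z>x. \<sigma>1 z = avail J z" using \<sigma>(2) y by (simp add: \<sigma>1_def)
    ultimately obtain \<tau> w where w: "0 \<le> w" and r2: "reach J (parked x \<sigma>1 e) (parked x \<tau> e)"
      and v: "round_trip J \<longrightarrow> reach_via_oasis J (parked x \<sigma>1 e) (parked x \<tau> e)"
      and \<tau>: "\<tau> x = \<sigma>1 x - N0 + B0 + w" "\<forall>z<x. \<tau> z = \<sigma>1 z"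
      and rest: "\<forall>\<sigma>' e'. w \<le> \<sigma>' x \<longrightarrow> (\<forall>z>x. \<sigma>' z = \<tau> z) \<longrightarrow>
        (\<exists>\<tau>'. reach J (parked x \<sigma>' e') (parked (if round_trip J then x else oasis J) \<tau>' e') \<and>
          \<tau>' x = \<sigma>' x - w \<and> (\<forall>z<x. \<tau>' z = \<sigma>' z) \<and> (\<forall>z>x. req J z \<le> \<tau>' z))"
      using x unfolding feasible_def by blast
    show ?thesis
    proof (intro exI conjI)
      show "0 \<le> w" by fact
      show "reach J (parked y \<sigma> e) (parked x \<tau> e)" using r1 r2 by (rule rtranclp_trans)
      show "round_trip J \<longrightarrow> reach_via_oasis J (parked y \<sigma> e) (parked x \<tau> e)"
        using v reach_via_oasis_trans(1)[OF r1] by blast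
      show "\<tau> x = req J x + B1 + (D - N1) + w"
        using \<tau>(1) N1(2) \<sigma>(2) y by (simp add: \<sigma>1_def)
      show "\<tau> y = \<sigma> y - N" "\<forall>z<y. \<tau> z = \<sigma> z" "\<forall>z. y < z \<longrightarrow> z < x \<longrightarrow> \<tau> z = 0"
        using \<tau>(2) y \<sigma>(2) z0 by (auto simp: \<sigma>1_def)
    qed (fact rest)
  qed
  show ?thesis
    unfolding feasible_def
  proof (intro allI impI)
    fix \<sigma> :: "real \<Rightarrow> real" and e
    assume \<sigma>: "N \<le> \<sigma> y" "\<forall>z>y. \<sigma> z = avail J z"
    let ?P = "\<lambda>\<tau> w. 0 \<le> w \<and> reach J (parked y \<sigma> e) (parked y \<tau> e) \<and>
        (round_trip J \<longrightarrow> reach_via_oasis J (parked y \<sigma> e) (parked y \<tau> e)) \<and>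
        \<tau> y = \<sigma> y - N + B + w \<and> (\<forall>z<y. \<tau> z = \<sigma> z) \<and>
        (\<forall>\<sigma>' e'. w \<le> \<sigma>' y \<longrightarrow> (\<forall>z>y. \<sigma>' z = \<tau> z) \<longrightarrow>
          (\<exists>\<tau>'. reach J (parked y \<sigma>' e') (parked (if round_trip J then y else oasis J) \<tau>' e') \<and>
            \<tau>' y = \<sigma>' y - w \<and> (\<forall>z<y. \<tau>' z = \<sigma>' z) \<and> (\<forall>z>y. req J z \<le> \<tau>' z)))"
    obtain \<tau> w where w: "0 \<le> w" and r: "reach J (parked y \<sigma> e) (parked x \<tau> e)"
      and v: "round_trip J \<longrightarrow> reach_via_oasis J (parked y \<sigma> e) (parked x \<tau> e)"
      and \<tau>: "\<tau> x = req J x + B1 + (D - N1) + w" "\<tau> y = \<sigma> y - N" "\<forall>z<y. \<tau> z = \<sigma> z"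
        "\<And>z. y < z \<Longrightarrow> z < x \<Longrightarrow> \<tau> z = 0"
      and rest: "\<And>\<sigma>' e'. w \<le> \<sigma>' x \<Longrightarrow> \<forall>z>x. \<sigma>' z = \<tau> z \<Longrightarrow>
        \<exists>\<tau>'. reach J (parked x \<sigma>' e') (parked (if round_trip J then x else oasis J) \<tau>' e') \<and>
          \<tau>' x = \<sigma>' x - w \<and> (\<forall>z<x. \<tau>' z = \<sigma>' z) \<and> (\<forall>z>x. req J z \<le> \<tau>' z)"
      using forward[OF \<sigma>, of e] by blast
    show "\<exists>\<tau> w. ?P \<tau> w"
    proof (cases "round_trip J")
      case True
      then have r1: "ringles J = 1" by (simp add: ringles_def)
      have "w \<le> \<tau> x" using \<tau>(1) req B1 D by simp
      then obtain \<tau>' where r': "reach J (parked x \<tau> e) (parked x \<tau>' e)"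
        and \<tau>': "\<tau>' x = req J x + B1 + (D - N1)" "\<forall>z<x. \<tau>' z = \<tau> z" "\<forall>z>x. req J z \<le> \<tau>' z"
        using rest[of \<tau> e] \<tau>(1) True by auto
      define R where "R = B1 + (D - N1)"
      \<comment> \<open>The way back consists of \<open>\<beta>\<close> shuttles and a final
        passage. In the improper case \<open>\<beta>\<close> is 0 and \<open>R = l\<close> is just
        enough to arrive empty; otherwise \<open>\<beta>\<close> is \<open>b\<close>.\<close>
      have "\<exists>\<beta>. R \<le> real \<beta> + 1 \<and> R - (2 * real \<beta> + 1) * l = B \<and> real \<beta> \<le> B"
        using ab
      proof (elim disjE conjE)
        assume "B1 = 0" "B = 0" "N = N1 + (2 * real a + 1 + real (ringles J)) * l"
        then show ?thesis using l1 r1 by (intro exI[of _ 0]) (simp add: R_def D_def algebra_simps)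
      next
        assume "1 \<le> b + ringles J" "B1 \<le> real (b + ringles J)" "real (b + ringles J) \<le> B + 1"
          "N = N1 + (2 * real a + 1) * l" "B = B1 - (2 * real b + real (ringles J)) * l"
        then show ?thesis using r1 by (intro exI[of _ b]) (simp add: R_def D_def algebra_simps)
      qed
      then obtain \<beta> where \<beta>: "R \<le> real \<beta> + 1" "R - (2 * real \<beta> + 1) * l = B" "real \<beta> \<le> B" by blast
      define \<tau>2 where "\<tau>2 = \<tau>'(x := \<tau>' x - R, y := \<tau>' y + B)"
      have r2: "reach J (parked x \<tau>' e) (parked y \<tau>2 e)"
        unfolding \<tau>2_def \<beta>(2)[symmetric] l(3)[symmetric]
        using y \<beta> \<tau>'(1) req by (intro reach_shuttles) (auto simp: l R_def)
      have "?P \<tau>2 0"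
      proof (intro conjI allI impI)
        show "reach J (parked y \<sigma> e) (parked y \<tau>2 e)" using r r' r2 by simp
        show "reach_via_oasis J (parked y \<sigma> e) (parked y \<tau>2 e)"
          using v True r' r2 reach_via_oasis_trans(2) by blast
        show "\<tau>2 y = \<sigma> y - N + B + 0"
          using y \<tau>' \<tau> by (auto simp: \<tau>2_def)
        show "\<tau>2 z = \<sigma> z" if "z < y" for z
          using that y \<tau>' \<tau> by (auto simp: \<tau>2_def)
        have c: "req J z \<le> \<tau>2 z" if "y < z" for z
          using that y \<tau>' \<tau>(4) z0[of z] by (cases z x rule: linorder_cases) (auto simp: \<tau>2_def R_def)
        fix \<sigma>' :: "real \<Rightarrow> real" and e'
        assume "\<forall>z>y. \<sigma>' z = \<tau>2 z"
        then show "\<exists>\<tau>'. reach J (parked y \<sigma>' e') (parked (if round_trip J then y else oasis J) \<tau>' e') \<and>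
            \<tau>' y = \<sigma>' y - 0 \<and> (\<forall>z<y. \<tau>' z = \<sigma>' z) \<and> (\<forall>z>y. req J z \<le> \<tau>' z)"
          using True c by (intro exI[of _ \<sigma>']) auto
      qed (use y \<tau>' \<tau> in \<open>auto simp: \<tau>2_def\<close>)
      then show ?thesis by blast
    next
      case False
      then have r0: "ringles J = 0" by (simp add: ringles_def)
      have DN: "D = N1" using ab r0 by (auto simp: D_def)
      from ab show ?thesis
      proof (elim disjE conjE)
        assume i: "B1 = 0" "B = 0" "N = N1 + (2 * real a + 1 + real (ringles J)) * l"
        \<comment> \<open>There is no surplus to bring back, so the interruption is placed before
          the crossing: the whole tour beyond \<open>y\<close> is deferred, with \<open>N\<close> as
          its reserve.\<close>
        have "?P \<sigma> N"
        proof (intro conjI allI impI)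
          show "0 \<le> N" using a(1) i(3) al l by (simp add: algebra_simps)
          fix \<sigma>' :: "real \<Rightarrow> real" and e'
          assume \<sigma>': "N \<le> \<sigma>' y" "\<forall>z>y. \<sigma>' z = \<sigma> z"
          then have "\<forall>z>y. \<sigma>' z = avail J z" using \<sigma> by simp
          from forward[OF \<sigma>'(1) this, of e'] obtain \<tau> w where r: "reach J (parked y \<sigma>' e') (parked x \<tau> e')"
            and \<tau>: "\<tau> x = req J x + B1 + (D - N1) + w" "\<tau> y = \<sigma>' y - N" "\<forall>z<y. \<tau> z = \<sigma>' z"
              "\<And>z. y < z \<Longrightarrow> z < x \<Longrightarrow> \<tau> z = 0"
            and rest: "\<And>\<sigma>' e'. w \<le> \<sigma>' x \<Longrightarrow> \<forall>z>x. \<sigma>' z = \<tau> z \<Longrightarrow>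
              \<exists>\<tau>'. reach J (parked x \<sigma>' e') (parked (if round_trip J then x else oasis J) \<tau>' e') \<and>
                \<tau>' x = \<sigma>' x - w \<and> (\<forall>z<x. \<tau>' z = \<sigma>' z) \<and> (\<forall>z>x. req J z \<le> \<tau>' z)"
            by blast
          have "w \<le> \<tau> x" using \<tau>(1) req i DN by simp
          then obtain \<tau>' where r': "reach J (parked x \<tau> e') (parked (oasis J) \<tau>' e')"
            and \<tau>': "\<tau>' x = req J x" "\<forall>z<x. \<tau>' z = \<tau> z" "\<forall>z>x. req J z \<le> \<tau>' z"
            using rest[of \<tau> e'] \<tau>(1) False i DN by auto
          have "req J z \<le> \<tau>' z" if "y < z" for z
            using that \<tau>' \<tau>(4) z0[of z] by (cases z x rule: linorder_cases) auto
          moreover have "reach J (parked y \<sigma>' e') (parked (oasis J) \<tau>' e')" using r r' by simp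
          ultimately show "\<exists>\<tau>'. reach J (parked y \<sigma>' e') (parked (if round_trip J then y else oasis J) \<tau>' e') \<and>
              \<tau>' y = \<sigma>' y - N \<and> (\<forall>z<y. \<tau>' z = \<sigma>' z) \<and> (\<forall>z>y. req J z \<le> \<tau>' z)"
            using False \<tau> \<tau>' y by (intro exI[of _ \<tau>']) auto
        qed (use False i in auto)
        then show ?thesis by blast
      next
        assume p: "1 \<le> b + ringles J" "B1 \<le> real (b + ringles J)" "real (b + ringles J) \<le> B + 1"
          "N = N1 + (2 * real a + 1) * l" "B = B1 - (2 * real b + real (ringles J)) * l"
        \<comment> \<open>Of the \<open>2 * b\<close> passages, \<open>2 * b' + 1\<close> bring the
          surplus back to \<open>y\<close>. The remaining one is the outward passage after the
          interruption, and its fuel \<open>l\<close> is the reserve at \<open>y\<close>.\<close>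
        then obtain b' where b': "b = Suc b'" using r0 by (cases b) auto
        have Bl: "B1 - (2 * real b' + 1) * l = B + l"
          using p(5) r0 by (simp add: b' algebra_simps)
        define \<tau>1 where "\<tau>1 = \<tau>(x := \<tau> x - B1, y := \<tau> y + (B + l))"
        have r1: "reach J (parked x \<tau> e) (parked y \<tau>1 e)"
          unfolding \<tau>1_def Bl[symmetric] unfolding l(3)[symmetric]
          using y p(2,3) r0 b' \<tau>(1) req w DN l Bl by (intro reach_shuttles) auto
        have "?P \<tau>1 l"
        proof (intro conjI allI impI)
          show "reach J (parked y \<sigma> e) (parked y \<tau>1 e)" using r r1 by simp
          fix \<sigma>' :: "real \<Rightarrow> real" and e'
          assume \<sigma>': "l \<le> \<sigma>' y" "\<forall>z>y. \<sigma>' z = \<tau>1 z"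
          define \<sigma>2 where "\<sigma>2 = \<sigma>'(y := \<sigma>' y - l, x := \<sigma>' x + (l - l))"
          have r2: "reach J (parked y \<sigma>' e') (parked x \<sigma>2 e')"
            using reach_transport[of x J y l \<sigma>' e'] y l l1 \<sigma>'(1) unfolding \<sigma>2_def by simp
          have \<sigma>2: "\<sigma>2 x = req J x + w" "\<forall>z>x. \<sigma>2 z = \<tau> z"
            using \<sigma>'(2) y \<tau>(1) DN by (auto simp: \<sigma>2_def \<tau>1_def)
          then obtain \<tau>' where r': "reach J (parked x \<sigma>2 e') (parked (oasis J) \<tau>' e')"
            and \<tau>': "\<tau>' x = req J x" "\<forall>z<x. \<tau>' z = \<sigma>2 z" "\<forall>z>x. req J z \<le> \<tau>' z"
            using rest[of \<sigma>2 e'] False req by auto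
          have "req J z \<le> \<tau>' z" if "y < z" for z
            using that \<tau>' \<tau>(4) z0[of z] \<sigma>'(2) by (cases z x rule: linorder_cases) (auto simp: \<sigma>2_def \<tau>1_def)
          moreover have "reach J (parked y \<sigma>' e') (parked (oasis J) \<tau>' e')" using r2 r' by simp
          ultimately show "\<exists>\<tau>'. reach J (parked y \<sigma>' e') (parked (if round_trip J then y else oasis J) \<tau>' e') \<and>
              \<tau>' y = \<sigma>' y - l \<and> (\<forall>z<y. \<tau>' z = \<sigma>' z) \<and> (\<forall>z>y. req J z \<le> \<tau>' z)"
            using False \<tau>' y by (intro exI[of _ \<tau>']) (auto simp: \<sigma>2_def)
        qed (use False l \<tau> y in \<open>auto simp: \<tau>1_def\<close>)
        then show ?thesis by blast
      qed
    qed
  qed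
qed

text \<open>At the oasis nothing lies beyond, so the empty tour is enough; a depot at the oasis
  itself is dealt with by the step that leaves it.\<close>

lemma feasible_plan:
  assumes "plan J x N B" "0 < oasis J" "depots J \<subseteq> {0<..oasis J}"
    and "\<And>x. x \<in> depots J \<Longrightarrow> 0 \<le> required J x"
  shows "feasible J x N B"
  using assms(1)
proof induction
  case start
  have z: "avail J z = 0" "req J z = 0" if "oasis J < z" for z
    using assms(3) that by (auto simp: avail_def req_def)
  show ?case
    unfolding feasible_def
  proof (intro allI impI)
    fix \<sigma> :: "real \<Rightarrow> real" and e
    assume \<sigma>: "\<forall>z>oasis J. \<sigma> z = avail J z"
    let ?o = "oasis J"
    show "\<exists>\<tau> w. 0 \<le> w \<and> reach J (parked ?o \<sigma> e) (parked ?o \<tau> e) \<and>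
        (round_trip J \<longrightarrow> reach_via_oasis J (parked ?o \<sigma> e) (parked ?o \<tau> e)) \<and>
        \<tau> ?o = \<sigma> ?o - 0 + 0 + w \<and> (\<forall>z<?o. \<tau> z = \<sigma> z) \<and>
        (\<forall>\<sigma>' e'. w \<le> \<sigma>' ?o \<longrightarrow> (\<forall>z>?o. \<sigma>' z = \<tau> z) \<longrightarrow>
          (\<exists>\<tau>'. reach J (parked ?o \<sigma>' e') (parked (if round_trip J then ?o else ?o) \<tau>' e') \<and>
            \<tau>' ?o = \<sigma>' ?o - w \<and> (\<forall>z<?o. \<tau>' z = \<sigma>' z) \<and> (\<forall>z>?o. req J z \<le> \<tau>' z)))"
    proof (rule exI[of _ \<sigma>], rule exI[of _ 0], intro conjI allI impI)
      show "reach_via_oasis J (parked ?o \<sigma> e) (parked ?o \<sigma> e)"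
        unfolding reach_via_oasis_def by (rule exI[of _ "parked ?o \<sigma> e"]) (simp add: parked_def)
      fix \<sigma>' :: "real \<Rightarrow> real" and e'
      assume "\<forall>z>?o. \<sigma>' z = \<sigma> z"
      then have "\<forall>z>?o. req J z \<le> \<sigma>' z" using \<sigma> z by simp
      then show "\<exists>\<tau>'. reach J (parked ?o \<sigma>' e') (parked (if round_trip J then ?o else ?o) \<tau>' e') \<and>
          \<tau>' ?o = \<sigma>' ?o - 0 \<and> (\<forall>z<?o. \<tau>' z = \<sigma>' z) \<and> (\<forall>z>?o. req J z \<le> \<tau>' z)"
        by (intro exI[of _ \<sigma>']) simp
    qed simp_all
  qed
next
  case (step x N B y N' B')
  show ?case
  proof (rule feasible_step[OF step.IH step.hyps(2,3) _ step.hyps(4) _ step.hyps(5)])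
    show "x \<le> oasis J" using plan_range[OF step.hyps(1)] assms(2) by simp
    show "0 \<le> req J x" using assms(4) by (simp add: req_def)
  qed
qed

section \<open>Fuel exchange at the border and assembly of the complete schedule\<close>

lemma reach_draw:
  assumes "0 \<le> N"
  shows "reach J (parked 0 \<sigma> e) (parked 0 (\<sigma>(0 := \<sigma> 0 + N)) (e + N))"
proof -
  have one: "reach J (parked 0 \<sigma> e) (parked 0 (\<sigma>(0 := \<sigma> 0 + t)) (e + t))"
    if "0 \<le> t" "t \<le> 1" for t \<sigma> e
  proof -
    define s1 where "s1 = \<lparr>loc = 0, tank = t, stock = \<sigma>, spent = e + t\<rparr>"
    have "jeep_step J (parked 0 \<sigma> e) s1"
      using that jeep_step.draw[of "parked 0 \<sigma> e" t J] by (simp add: parked_def s1_def)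
    moreover have "jeep_step J s1 (parked 0 (\<sigma>(0 := \<sigma> 0 + t)) (e + t))"
      using that jeep_step.unload[of t s1 J] by (simp add: parked_def s1_def)
    ultimately show ?thesis by (meson converse_rtranclp_into_rtranclp rtranclp.rtrancl_refl)
  qed
  obtain n where "N \<le> real n" using real_arch_simple by blast
  with assms show ?thesis
  proof (induction n arbitrary: N \<sigma> e)
    case 0
    then show ?case using one[of 0] by simp
  next
    case (Suc n)
    show ?case
    proof (cases "N \<le> 1")
      case False
      define \<sigma>1 where "\<sigma>1 = \<sigma>(0 := \<sigma> 0 + 1)"
      have r1: "reach J (parked 0 \<sigma> e) (parked 0 \<sigma>1 (e + 1))"
        unfolding \<sigma>1_def using False Suc.prems by (intro one) simp_all
      have r2: "reach J (parked 0 \<sigma>1 (e + 1)) (parked 0 (\<sigma>1(0 := \<sigma>1 0 + (N - 1))) (e + 1 + (N - 1)))"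
        using False Suc.prems by (intro Suc.IH) (simp_all add: \<sigma>1_def)
      have eq: "\<sigma>1(0 := \<sigma>1 0 + (N - 1)) = \<sigma>(0 := \<sigma> 0 + N)" "e + 1 + (N - 1) = e + N"
        by (simp_all add: \<sigma>1_def fun_eq_iff)
      show ?thesis using rtranclp_trans[OF r1 r2] unfolding eq .
    qed (rule one; use Suc.prems in simp)
  qed
qed

lemma reach_give_back:
  assumes "0 \<le> B" "returning J" "B \<le> \<sigma> 0"
  shows "reach J (parked 0 \<sigma> e) (parked 0 (\<sigma>(0 := \<sigma> 0 - B)) (e - B))"
proof -
  have one: "reach J (parked 0 \<sigma> e) (parked 0 (\<sigma>(0 := \<sigma> 0 - t)) (e - t))"
    if "0 \<le> t" "t \<le> 1" "t \<le> \<sigma> 0" for t \<sigma> e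
  proof -
    define s1 where "s1 = \<lparr>loc = 0, tank = t, stock = \<sigma>(0 := \<sigma> 0 - t), spent = e\<rparr>"
    have "jeep_step J (parked 0 \<sigma> e) s1"
      using that jeep_step.load[of t "parked 0 \<sigma> e" J] by (simp add: parked_def s1_def)
    moreover have "jeep_step J s1 (parked 0 (\<sigma>(0 := \<sigma> 0 - t)) (e - t))"
      using that assms(2) jeep_step.give_back[of J s1 t] by (simp add: parked_def s1_def)
    ultimately show ?thesis by (meson converse_rtranclp_into_rtranclp rtranclp.rtrancl_refl)
  qed
  obtain n where "B \<le> real n" using real_arch_simple by blast
  with assms(1,3) show ?thesis
  proof (induction n arbitrary: B \<sigma> e)
    case 0
    then show ?case using one[of 0] by simp
  next
    case (Suc n)
    show ?case
    proof (cases "B \<le> 1")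
      case False
      define \<sigma>1 where "\<sigma>1 = \<sigma>(0 := \<sigma> 0 - 1)"
      have r1: "reach J (parked 0 \<sigma> e) (parked 0 \<sigma>1 (e - 1))"
        unfolding \<sigma>1_def using False Suc.prems by (intro one) simp_all
      have r2: "reach J (parked 0 \<sigma>1 (e - 1)) (parked 0 (\<sigma>1(0 := \<sigma>1 0 - (B - 1))) (e - 1 - (B - 1)))"
        using False Suc.prems by (intro Suc.IH) (simp_all add: \<sigma>1_def)
      have eq: "\<sigma>1(0 := \<sigma>1 0 - (B - 1)) = \<sigma>(0 := \<sigma> 0 - B)" "e - 1 - (B - 1) = e - B"
        by (simp_all add: \<sigma>1_def fun_eq_iff)
      show ?thesis using rtranclp_trans[OF r1 r2] unfolding eq .
    qed (rule one; use Suc.prems in simp)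
  qed
qed

definition trace :: "task \<Rightarrow> jeep list \<Rightarrow> bool" where
  "trace J ss \<longleftrightarrow> ss \<noteq> [] \<and> (\<forall>i. Suc i < length ss \<longrightarrow> jeep_step J (ss ! i) (ss ! Suc i))"

lemma trace_snoc:
  assumes "trace J ss" "jeep_step J (last ss) t"
  shows "trace J (ss @ [t])"
  unfolding trace_def
proof (intro conjI allI impI)
  fix i assume "Suc i < length (ss @ [t])"
  then consider "Suc i < length ss" | "i = length ss - 1" "ss \<noteq> []" using assms(1) by (fastforce simp: trace_def)
  then show "jeep_step J ((ss @ [t]) ! i) ((ss @ [t]) ! Suc i)"
    using assms by cases (auto simp: trace_def nth_append last_conv_nth)
qed simp

text \<open>The inclusion of the sets keeps the state at the oasis in the list when the rest of the
  trip is appended.\<close>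

lemma trace_extend:
  assumes "reach J s t" "trace J ss" "last ss = s"
  shows "\<exists>ts. trace J ts \<and> hd ts = hd ss \<and> last ts = t \<and> set ss \<subseteq> set ts"
  using assms
proof (induction rule: rtranclp_induct)
  case (step t u)
  then obtain ts where "trace J ts" "hd ts = hd ss" "last ts = t" "set ss \<subseteq> set ts" by blast
  with step.hyps(2) trace_snoc[of J ts u] show ?case
    by (intro exI[of _ "ts @ [u]"]) (auto simp: trace_def)
qed auto

lemma reach_via_oasis_imp_normal_algorithm:
  assumes "reach_via_oasis J (jeep_start J) s" "loc s = (if round_trip J then 0 else oasis J)"
    and "\<forall>x\<in>depots J. required J x \<le> stock s x"
  shows "\<exists>ss. normal_algorithm J ss \<and> normal_cost ss = spent s"
proof -
  obtain m where m: "reach J (jeep_start J) m" "loc m = oasis J" "reach J m s"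
    using assms(1) by (auto simp: reach_via_oasis_def)
  have "trace J [jeep_start J]" by (simp add: trace_def)
  from trace_extend[OF m(1) this] obtain ss where ss: "trace J ss" "hd ss = jeep_start J" "last ss = m"
    by auto
  from trace_extend[OF m(3) ss(1,3)] obtain ts
    where ts: "trace J ts" "hd ts = jeep_start J" "last ts = s" "set ss \<subseteq> set ts"
    using ss by auto
  have "m \<in> set ts" using ss ts by (auto simp: trace_def)
  then show ?thesis
    using ts m(2) assms(2,3) by (intro exI[of _ ts]) (auto simp: normal_algorithm_def normal_cost_def trace_def)
qed

text \<open>All of \<open>N\<close> is drawn into a depot at 0 in advance, so the border can be
  treated like any other point. Returning \<open>B\<close> has to happen at the interruption, since
  a one-way jeep ends at the oasis; the reserve \<open>w\<close> for the rest of the tour stays at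
  0.\<close>

lemma plan_achievable:
  assumes plan: "plan J 0 N B" and J: "0 < oasis J" "depots J \<subseteq> {0<..oasis J}"
    and "\<And>x. x \<in> depots J \<Longrightarrow> 0 \<le> required J x"
  shows "\<exists>ss. normal_algorithm J ss \<and> normal_cost ss = N - (if returning J then B else 0)"
proof -
  have N: "0 \<le> N" "0 \<le> B" using plan_nonneg[OF plan] by auto
  have start: "jeep_start J = parked 0 (avail J) 0"
    by (simp add: jeep_start_def parked_def avail_def fun_eq_iff)
  define \<sigma> where "\<sigma> = (avail J)(0 := avail J 0 + N)"
  have r0: "reach J (parked 0 (avail J) 0) (parked 0 \<sigma> N)"
    using reach_draw[OF N(1), of J "avail J" 0] by (simp add: \<sigma>_def)
  have "0 \<notin> depots J" using J by auto
  then have \<sigma>0: "\<sigma> 0 = N" by (simp add: \<sigma>_def avail_def)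
  moreover have "\<forall>z>0. \<sigma> z = avail J z" by (simp add: \<sigma>_def)
  ultimately obtain \<tau> w where w: "0 \<le> w" and r1: "reach J (parked 0 \<sigma> N) (parked 0 \<tau> N)"
    and v: "round_trip J \<longrightarrow> reach_via_oasis J (parked 0 \<sigma> N) (parked 0 \<tau> N)"
    and \<tau>: "\<tau> 0 = B + w"
    and rest: "\<And>\<sigma>' e'. w \<le> \<sigma>' 0 \<Longrightarrow> \<forall>z>0. \<sigma>' z = \<tau> z \<Longrightarrow>
      \<exists>\<tau>'. reach J (parked 0 \<sigma>' e') (parked (if round_trip J then 0 else oasis J) \<tau>' e') \<and>
        \<tau>' 0 = \<sigma>' 0 - w \<and> (\<forall>z<0. \<tau>' z = \<sigma>' z) \<and> (\<forall>z>0. req J z \<le> \<tau>' z)"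
    using feasible_plan[OF assms, unfolded feasible_def, rule_format, of \<sigma> N] by auto
  define c where "c = (if returning J then B else 0)"
  define \<tau>1 where "\<tau>1 = \<tau>(0 := \<tau> 0 - c)"
  have r2: "reach J (parked 0 \<tau> N) (parked 0 \<tau>1 (N - c))"
  proof (cases "returning J")
    case True
    then have c: "c = B" by (simp add: c_def)
    have "B \<le> \<tau> 0" using \<tau> w by simp
    with N(2) True show ?thesis unfolding \<tau>1_def c by (rule reach_give_back)
  qed (simp add: \<tau>1_def c_def)
  have "w \<le> \<tau>1 0" using \<tau> N by (simp add: \<tau>1_def c_def)
  moreover have "\<forall>z>0. \<tau>1 z = \<tau> z" by (simp add: \<tau>1_def)
  ultimately obtain \<tau>2
    where r3: "reach J (parked 0 \<tau>1 (N - c)) (parked (if round_trip J then 0 else oasis J) \<tau>2 (N - c))"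
      and \<tau>2: "\<forall>z>0. req J z \<le> \<tau>2 z"
    using rest by blast
  have "reach_via_oasis J (jeep_start J) (parked (if round_trip J then 0 else oasis J) \<tau>2 (N - c))"
  proof (cases "round_trip J")
    case True
    then have "reach_via_oasis J (parked 0 \<sigma> N) (parked 0 \<tau> N)" using v by simp
    from reach_via_oasis_trans(1)[OF r0 this] r2 r3 show ?thesis
      unfolding start by (meson reach_via_oasis_trans(2))
  next
    case False
    have "reach J (jeep_start J) (parked (if round_trip J then 0 else oasis J) \<tau>2 (N - c))"
      unfolding start using r0 r1 r2 r3 by (meson rtranclp_trans)
    then show ?thesis using False by (auto simp: reach_via_oasis_def parked_def)
  qed
  moreover have "required J x \<le> \<tau>2 x" if "x \<in> depots J" for x
  proof -
    have "0 < x" using that J by auto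
    then have "req J x \<le> \<tau>2 x" using \<tau>2 by blast
    then show ?thesis using that by (simp add: req_def)
  qed
  ultimately have "\<exists>ss. normal_algorithm J ss \<and>
      normal_cost ss = spent (parked (if round_trip J then 0 else oasis J) \<tau>2 (N - c))"
    by (intro reach_via_oasis_imp_normal_algorithm) (auto simp: parked_def)
  then show ?thesis by (simp add: parked_def c_def)
qed

theorem theorem1p1:
  fixes J :: task
  assumes "0 < oasis J"
    and "finite (depots J)"
    and "depots J \<subseteq> {0<..oasis J}"
    and "\<And>x. x \<in> depots J \<Longrightarrow> 0 \<le> available J x"
    and "\<And>x. x \<in> depots J \<Longrightarrow> 0 \<le> required J x"
  shows "(\<forall>ss. normal_algorithm J ss \<longrightarrow> convoy_cost J \<le> normal_cost ss) \<and>
         (\<exists>ss. normal_algorithm J ss \<and> normal_cost ss = convoy_cost J)"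
proof -
  obtain N B where plan: "plan J 0 N B" and cost: "convoy_cost J = N - (if returning J then B else 0)"
    using convoy_plan[OF assms] by blast
  have "convoy_cost J \<le> normal_cost ss" if "normal_algorithm J ss" for ss
  proof -
    interpret schedule J ss using assms that by unfold_locales auto
    show ?thesis using plan_le_cost[OF plan] cost by simp
  qed
  moreover have "\<exists>ss. normal_algorithm J ss \<and> normal_cost ss = convoy_cost J"
    using plan_achievable[OF plan assms(1,3,5)] cost by simp
  ultimately show ?thesis by blast
qed

end
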